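(* Let $h=(h_1,\ldots,h_{m_1})$ and $g=(g_1,\ldots,g_{m_2})$ be tuples of polynomials in $\mathbb{R}[x]=\mathbb{R}[x_1,\ldots,x_n]$, let $K=\{x\in\mathbb{R}^n: h(x)=0,\ g(x)\ge 0\}$, let $\mathcal{A}\subseteq\mathbb{N}^n$ be finite, and let $a_1,\ldots,a_m\in\mathbb{R}[x]_{\mathcal{A}}$ and $b\in\mathbb{R}^m$. Consider the feasibility problems $$\text{(F)}\quad \langle a_i,y\rangle=b_i\ (i=1,\ldots,m),\quad y\in\mathscr{R}_{\mathcal{A}}(K),$$ and, for orders $k\ge\deg(\mathcal{A})/2$, $$\text{(F}_k)\quad \langle a_i,y\rangle=b_i\ (i=1,\ldots,m),\quad y=w|_{\mathcal{A}},\quad w\in\Phi_k(g)\cap E_k(h),$$ and the condition on $\lambda\in\mathbb{R}^m$ and $k\in\mathbb{N}$ $$(\ast)\quad b^T\lambda<0,\qquad \lambda_1a_1+\cdots+\lambda_ma_m\in Q_k(g)+I_{2k}(h).$$ Then: (i) (F) is infeasible if (F$_k$) is infeasible for some order $k$; and (F$_k$) is infeasible for some order $k$ if there exist $\lambda$ and $k$ satisfying $(\ast)$. (ii) Suppose $I(h)+Q(g)$ is archimedean and there exists $a\in\mathrm{span}\{a_1,\ldots,a_m\}$ such that $a>0$ on $K$. If (F) is infeasible, then $(\ast)$ holds for some $\lambda,k$, and (F$_k$) is infeasible for some order $k$.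
   Context: $\mathbb{N}$ is the set of nonnegative integers, $\mathbb{N}^n_d=\{\alpha\in\mathbb{N}^n:|\alpha|\le d\}$ with $|\alpha|=\alpha_1+\cdots+\alpha_n$; $\mathbb{R}[x]_d$ is the space of polynomials of degree at most $d$ ($\{0\}$ for $d<0$). $\mathbb{R}[x]_{\mathcal{A}}=\mathrm{span}\{x^\alpha:\alpha\in\mathcal{A}\}$; $\mathbb{R}^{\mathcal{A}}$ is the space of real vectors $(y_\alpha)_{\alpha\in\mathcal{A}}$; $\deg(\mathcal{A})=\max\{|\alpha|:\alpha\in\mathcal{A}\}$; $\langle p,y\rangle=\sum_\alpha p_\alpha y_\alpha$. For $w\in\mathbb{R}^{\mathbb{N}^n_{2k}}$, $w|_{\mathcal{A}}$ is its subvector indexed by $\mathcal{A}$, and $\mathscr{L}_w(\sum_\alpha p_\alpha x^\alpha)=\sum_\alpha p_\alpha w_\alpha$. $\mathscr{R}_{\mathcal{A}}(K)$ is the set of $y\in\mathbb{R}^{\mathcal{A}}$ for which there is a (nonnegative) Borel measure $\mu$ supported in $K$ with $y_\alpha=\int x^\alpha d\mu$ for all $\alpha\in\mathcal{A}$. $\Sigma_{n,d}$ is the cone of sums of squares of degree at most $d$. $I_{\ell}(h)=\sum_i h_i\mathbb{R}[x]_{\ell-\deg(h_i)}$, $Q_k(g)=\Sigma_{n,2k}+\sum_j g_j\Sigma_{n,2k-\deg(g_j)}$, $I(h)=\bigcup_kI_{2k}(h)$, $Q(g)=\bigcup_kQ_k(g)$. $I(h)+Q(g)$ is archimedean if $R-\|x\|_2^2\in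 I(h)+Q(g)$ for some $R>0$. The localizing matrix $L_q^{(k)}(w)$ of a polynomial $q$ is the symmetric matrix with $\mathscr{L}_w(qp^2)=p^TL_q^{(k)}(w)p$ for all $p\in\mathbb{R}[x]$ with $\deg(qp^2)\le2k$ ($p$ also denotes its coefficient vector). With $g_0=1$: $\Phi_k(g)=\{w\in\mathbb{R}^{\mathbb{N}^n_{2k}}:L_{g_j}^{(k)}(w)\succeq0,\ j=0,\ldots,m_2\}$, $E_k(h)=\{w\in\mathbb{R}^{\mathbb{N}^n_{2k}}:L_{h_i}^{(k)}(w)=0,\ i=1,\ldots,m_1\}$. *)

theory Defs
  imports
    "HOL-Analysis.Analysis"
    "HOL-Analysis.Finite_Function_Topology"
    "HOL-Library.Poly_Mapping"
    "HOL-Library.Set_Algebras"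
begin

text \<open>
  The index type \<open>'n\<close> plays the role of \<open>{1,\<dots>,n}\<close>. Exponents in \<open>\<nat>\<^sup>n\<close> are vectors of type
  \<open>nat ^ 'n\<close>, and \<open>\<real>[x]\<close> is the monoid algebra of \<open>\<nat>\<^sup>n\<close>: finitely supported coefficient families
  with the convolution product of \<open>HOL-Library.Poly_Mapping\<close> and the real vector space structure of
  \<open>HOL-Analysis.Finite_Function_Topology\<close>. Tuples of polynomials are lists.
\<close>

type_synonym 'n expo = "nat ^ 'n"
type_synonym 'n rpoly = "(nat ^ 'n) \<Rightarrow>\<^sub>0 real"


section \<open>Polynomials\<close>

definition mdeg :: "'n::finite expo \<Rightarrow> nat"
  where "mdeg \<alpha> = (\<Sum>i\<in>UNIV. \<alpha> $ i)"

definition expos_upto :: "nat \<Rightarrow> ('n::finite expo) set"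
  where "expos_upto d = {\<alpha>. mdeg \<alpha> \<le> d}"

text \<open>The degree of a finite set of exponents; the empty set gets degree \<open>0\<close>.\<close>

definition deg_set :: "('n::finite expo) set \<Rightarrow> nat"
  where "deg_set A = Max (insert 0 (mdeg ` A))"

text \<open>Total degree, with \<open>deg 0 = 0\<close>.\<close>

definition tdeg :: "'n::finite rpoly \<Rightarrow> nat"
  where "tdeg p = deg_set (Poly_Mapping.keys p)"

definition pmonom :: "'n::finite expo \<Rightarrow> 'n rpoly"
  where "pmonom \<alpha> = Poly_Mapping.single \<alpha> 1"

definition pconst :: "real \<Rightarrow> 'n::finite rpoly"
  where "pconst c = Poly_Mapping.single 0 c"

definition pvar :: "'n::finite \<Rightarrow> 'n rpoly"
  where "pvar i = pmonom (axis i 1)"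

definition mono_eval :: "'n::finite expo \<Rightarrow> real ^ 'n \<Rightarrow> real"
  where "mono_eval \<alpha> x = (\<Prod>i\<in>UNIV. (x $ i) ^ (\<alpha> $ i))"

definition peval :: "'n::finite rpoly \<Rightarrow> real ^ 'n \<Rightarrow> real"
  where "peval p x = (\<Sum>\<alpha>\<in>Poly_Mapping.keys p. Poly_Mapping.lookup p \<alpha> * mono_eval \<alpha> x)"

text \<open>\<open>\<real>[x]\<^sub>d\<close>, for an integer \<open>d\<close>; it is \<open>{0}\<close> when \<open>d < 0\<close>.\<close>

definition polys_upto :: "int \<Rightarrow> ('n::finite rpoly) set"
  where "polys_upto d = {p. \<forall>\<alpha>\<in>Poly_Mapping.keys p. int (mdeg \<alpha>) \<le> d}"

definition polys_in :: "('n::finite expo) set \<Rightarrow> ('n rpoly) set"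
  where "polys_in A = span (pmonom ` A)"

text \<open>
  The bilinear pairing \<open>\<langle>p, y\<rangle>\<close> of a polynomial with a vector of (pseudo-)moments. With the arguments
  in this order it is also the Riesz functional \<open>\<L>\<^sub>w(p)\<close>.
\<close>

definition pairing :: "'n::finite rpoly \<Rightarrow> ('n expo \<Rightarrow> real) \<Rightarrow> real"
  where "pairing p y = (\<Sum>\<alpha>\<in>Poly_Mapping.keys p. Poly_Mapping.lookup p \<alpha> * y \<alpha>)"

abbreviation riesz :: "('n::finite expo \<Rightarrow> real) \<Rightarrow> 'n rpoly \<Rightarrow> real"
  where "riesz w p \<equiv> pairing p w"


section \<open>Semialgebraic sets and moments\<close>

definition semialg :: "('n::finite rpoly) list \<Rightarrow> ('n rpoly) list \<Rightarrow> (real ^ 'n) set"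
  where "semialg h g = {x. (\<forall>q\<in>set h. peval q x = 0) \<and> (\<forall>q\<in>set g. peval q x \<ge> 0)}"

text \<open>
  \<open>\<real>\<^sup>A\<close> is \<open>A \<rightarrow>\<^sub>E UNIV\<close>. Integrability has to be demanded explicitly, since the integral of a
  non-integrable function is \<open>0\<close> by convention. The measure is not assumed to be finite.
\<close>

definition moment_cone :: "('n::finite expo) set \<Rightarrow> (real ^ 'n) set \<Rightarrow> ('n expo \<Rightarrow> real) set"
  where "moment_cone A K =
    {y \<in> A \<rightarrow>\<^sub>E UNIV. \<exists>\<mu>. sets \<mu> = sets borel \<and> (AE x in \<mu>. x \<in> K) \<and>
       (\<forall>\<alpha>\<in>A. integrable \<mu> (mono_eval \<alpha>) \<and> y \<alpha> = integral\<^sup>L \<mu> (mono_eval \<alpha>))}"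


section \<open>Truncated ideals and quadratic modules\<close>

definition sos :: "('n::finite rpoly) set"
  where "sos = {sum_list (map (\<lambda>p. p ^ 2) ps) | ps. True}"

definition sos_upto :: "int \<Rightarrow> ('n::finite rpoly) set"
  where "sos_upto d = sos \<inter> polys_upto d"

definition ideal_trunc :: "nat \<Rightarrow> ('n::finite rpoly) list \<Rightarrow> ('n rpoly) set"
  where "ideal_trunc l h =
    {(\<Sum>i<length h. h ! i * p i) | p. \<forall>i<length h. p i \<in> polys_upto (int l - int (tdeg (h ! i)))}"

definition qmodule_trunc :: "nat \<Rightarrow> ('n::finite rpoly) list \<Rightarrow> ('n rpoly) set"
  where "qmodule_trunc k g =
    {\<sigma>\<^sub>0 + (\<Sum>j<length g. g ! j * \<sigma> j) | \<sigma>\<^sub>0 \<sigma>. \<sigma>\<^sub>0 \<in> sos_upto (int (2 * k)) \<and>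
       (\<forall>j<length g. \<sigma> j \<in> sos_upto (int (2 * k) - int (tdeg (g ! j))))}"

definition ideal_of :: "('n::finite rpoly) list \<Rightarrow> ('n rpoly) set"
  where "ideal_of h = (\<Union>k. ideal_trunc (2 * k) h)"

definition qmodule :: "('n::finite rpoly) list \<Rightarrow> ('n rpoly) set"
  where "qmodule g = (\<Union>k. qmodule_trunc k g)"

definition archimedean :: "('n::finite rpoly) list \<Rightarrow> ('n rpoly) list \<Rightarrow> bool"
  where "archimedean h g \<longleftrightarrow>
    (\<exists>R>0. pconst R - (\<Sum>i\<in>UNIV. pvar i ^ 2) \<in> ideal_of h + qmodule g)"


section \<open>Localizing matrices\<close>

text \<open>
  The monomials that may occur in \<open>p\<close> when \<open>deg (q p\<^sup>2) \<le> 2k\<close> and \<open>q \<noteq> 0\<close>; they index the rows and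
  columns of the \<open>k\<close>-th localizing matrix of \<open>q\<close>. If \<open>deg q > 2k\<close>, the matrix is empty.
\<close>

definition loc_index :: "nat \<Rightarrow> 'n::finite rpoly \<Rightarrow> ('n expo) set"
  where "loc_index k q = {\<alpha>. 2 * mdeg \<alpha> + tdeg q \<le> 2 * k}"

definition is_loc_matrix ::
    "nat \<Rightarrow> 'n::finite rpoly \<Rightarrow> ('n expo \<Rightarrow> real) \<Rightarrow> ('n expo \<Rightarrow> 'n expo \<Rightarrow> real) \<Rightarrow> bool"
  where "is_loc_matrix k q w M \<longleftrightarrow>
    (\<forall>\<alpha> \<beta>. M \<alpha> \<beta> = M \<beta> \<alpha>) \<and>
    (\<forall>\<alpha> \<beta>. \<alpha> \<notin> loc_index k q \<or> \<beta> \<notin> loc_index k q \<longrightarrow> M \<alpha> \<beta> = 0) \<and>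
    (\<forall>p. tdeg (q * p ^ 2) \<le> 2 * k \<longrightarrow>
       riesz w (q * p ^ 2) =
       (\<Sum>\<alpha>\<in>loc_index k q. \<Sum>\<beta>\<in>loc_index k q.
          Poly_Mapping.lookup p \<alpha> * M \<alpha> \<beta> * Poly_Mapping.lookup p \<beta>))"

text \<open>Existence and uniqueness are proved at the end of this theory.\<close>

definition loc_matrix ::
    "nat \<Rightarrow> 'n::finite rpoly \<Rightarrow> ('n expo \<Rightarrow> real) \<Rightarrow> 'n expo \<Rightarrow> 'n expo \<Rightarrow> real"
  where "loc_matrix k q w = (THE M. is_loc_matrix k q w M)"

definition psd_on :: "'i set \<Rightarrow> ('i \<Rightarrow> 'i \<Rightarrow> real) \<Rightarrow> bool"
  where "psd_on S M \<longleftrightarrow> (\<forall>\<alpha>\<in>S. \<forall>\<beta>\<in>S. M \<alpha> \<beta> = M \<beta> \<alpha>) \<and>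
    (\<forall>v. (\<Sum>\<alpha>\<in>S. \<Sum>\<beta>\<in>S. v \<alpha> * M \<alpha> \<beta> * v \<beta>) \<ge> 0)"

definition Phi_set :: "nat \<Rightarrow> ('n::finite rpoly) list \<Rightarrow> ('n expo \<Rightarrow> real) set"
  where "Phi_set k g = {w \<in> expos_upto (2 * k) \<rightarrow>\<^sub>E UNIV.
    \<forall>q\<in>set (1 # g). psd_on (loc_index k q) (loc_matrix k q w)}"

definition E_set :: "nat \<Rightarrow> ('n::finite rpoly) list \<Rightarrow> ('n expo \<Rightarrow> real) set"
  where "E_set k h = {w \<in> expos_upto (2 * k) \<rightarrow>\<^sub>E UNIV.
    \<forall>q\<in>set h. \<forall>\<alpha>\<in>loc_index k q. \<forall>\<beta>\<in>loc_index k q. loc_matrix k q w \<alpha> \<beta> = 0}"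


section \<open>The feasibility problems\<close>

definition feasible ::
    "('n::finite rpoly) list \<Rightarrow> real list \<Rightarrow> ('n expo) set \<Rightarrow> (real ^ 'n) set \<Rightarrow> bool"
  where "feasible a b A K \<longleftrightarrow>
    (\<exists>y \<in> moment_cone A K. \<forall>i<length a. pairing (a ! i) y = b ! i)"

definition is_order :: "('n::finite expo) set \<Rightarrow> nat \<Rightarrow> bool"
  where "is_order A k \<longleftrightarrow> real k \<ge> real (deg_set A) / 2"

definition feasible_rel ::
    "nat \<Rightarrow> ('n::finite rpoly) list \<Rightarrow> real list \<Rightarrow> ('n expo) set \<Rightarrow>
     ('n rpoly) list \<Rightarrow> ('n rpoly) list \<Rightarrow> bool"
  where "feasible_rel k a b A h g \<longleftrightarrow>
    (\<exists>y w. (\<forall>i<length a. pairing (a ! i) y = b ! i) \<and> y = restrict w A \<and> w \<in> Phi_set k g \<inter> E_set k h)"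

definition certificate ::
    "nat \<Rightarrow> real list \<Rightarrow> ('n::finite rpoly) list \<Rightarrow> real list \<Rightarrow>
     ('n rpoly) list \<Rightarrow> ('n rpoly) list \<Rightarrow> bool"
  where "certificate k lam a b h g \<longleftrightarrow>
    length lam = length a \<and>
    (\<Sum>i<length a. b ! i * lam ! i) < 0 \<and>
    (\<Sum>i<length a. (lam ! i) *\<^sub>R (a ! i)) \<in> qmodule_trunc k g + ideal_trunc (2 * k) h"


section \<open>Localizing matrices are well defined\<close>

lemma mdeg_add: "mdeg (\<alpha> + \<beta>) = mdeg \<alpha> + mdeg \<beta>"
  by (simp add: mdeg_def sum.distrib)

lemma tdeg_le_iff: "tdeg p \<le> d \<longleftrightarrow> (\<forall>\<alpha>\<in>Poly_Mapping.keys p. mdeg \<alpha> \<le> d)"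
  by (simp add: tdeg_def deg_set_def)

lemma mdeg_le_tdeg: "\<alpha> \<in> Poly_Mapping.keys p \<Longrightarrow> mdeg \<alpha> \<le> tdeg p"
  using tdeg_le_iff[of p "tdeg p"] by simp

lemma finite_expos: "finite {\<alpha> :: 'n::finite expo. mdeg \<alpha> \<le> d}"
proof -
  have "(\<lambda>\<alpha>. ($) \<alpha>) ` {\<alpha> :: 'n expo. mdeg \<alpha> \<le> d} \<subseteq> (UNIV :: 'n set) \<rightarrow>\<^sub>E {..d}"
  proof -
    have "\<alpha> $ i \<le> mdeg \<alpha>" for \<alpha> :: "'n expo" and i
      unfolding mdeg_def by (rule member_le_sum) auto
    then show ?thesis by (auto simp: PiE_iff intro: order_trans)
  qed
  then have "finite ((\<lambda>\<alpha>. ($) \<alpha>) ` {\<alpha> :: 'n expo. mdeg \<alpha> \<le> d})"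
    by (rule finite_subset) (auto intro: finite_PiE)
  then show ?thesis
    by (rule finite_imageD) (auto simp: inj_on_def vec_eq_iff)
qed

lemma finite_loc_index: "finite (loc_index k q)"
  by (rule finite_subset[OF _ finite_expos[of k]]) (auto simp: loc_index_def)

lemma poly_expand:
  fixes p :: "'n::finite rpoly"
  assumes "finite S" "Poly_Mapping.keys p \<subseteq> S"
  shows "p = (\<Sum>\<alpha>\<in>S. Poly_Mapping.single \<alpha> (Poly_Mapping.lookup p \<alpha>))"
proof (rule poly_mapping_eqI)
  fix \<gamma>
  have "Poly_Mapping.lookup (\<Sum>\<alpha>\<in>S. Poly_Mapping.single \<alpha> (Poly_Mapping.lookup p \<alpha>)) \<gamma>
      = (\<Sum>\<alpha>\<in>S. if \<alpha> = \<gamma> then Poly_Mapping.lookup p \<alpha> else 0)"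
    by (simp add: lookup_sum lookup_single when_def)
  also have "\<dots> = Poly_Mapping.lookup p \<gamma>"
    using assms by (auto simp: sum.delta in_keys_iff)
  finally show "Poly_Mapping.lookup p \<gamma> =
    Poly_Mapping.lookup (\<Sum>\<alpha>\<in>S. Poly_Mapping.single \<alpha> (Poly_Mapping.lookup p \<alpha>)) \<gamma>" by simp
qed

lemma mult_expand:
  fixes p q :: "'n::finite rpoly"
  assumes "finite S" "Poly_Mapping.keys p \<subseteq> S" "finite T" "Poly_Mapping.keys q \<subseteq> T"
  shows "p * q = (\<Sum>\<alpha>\<in>S. \<Sum>\<beta>\<in>T. Poly_Mapping.single (\<alpha> + \<beta>)
           (Poly_Mapping.lookup p \<alpha> * Poly_Mapping.lookup q \<beta>))"
proof -
  have "p * q = (\<Sum>\<alpha>\<in>S. Poly_Mapping.single \<alpha> (Poly_Mapping.lookup p \<alpha>)) *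
      (\<Sum>\<beta>\<in>T. Poly_Mapping.single \<beta> (Poly_Mapping.lookup q \<beta>))"
    by (rule arg_cong2[OF poly_expand[OF assms(1,2)] poly_expand[OF assms(3,4)]])
  then show ?thesis by (simp add: sum_product mult_single)
qed

lemma pairing_superset:
  assumes "finite S" "Poly_Mapping.keys p \<subseteq> S"
  shows "pairing p w = (\<Sum>\<alpha>\<in>S. Poly_Mapping.lookup p \<alpha> * w \<alpha>)"
  unfolding pairing_def
  by (rule sum.mono_neutral_left) (use assms in \<open>auto simp: in_keys_iff\<close>)

lemma pairing_zero [simp]: "pairing 0 w = 0"
  by (simp add: pairing_def)

lemma pairing_add: "pairing (p + q) w = pairing p w + pairing q w"
proof -
  let ?S = "Poly_Mapping.keys p \<union> Poly_Mapping.keys q"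
  have "Poly_Mapping.keys (p + q) \<subseteq> ?S" by (rule Poly_Mapping.keys_add)
  then show ?thesis
    by (simp add: pairing_superset[of ?S] lookup_add distrib_right sum.distrib)
qed

lemma pairing_sum: "pairing (\<Sum>i\<in>I. f i) w = (\<Sum>i\<in>I. pairing (f i) w)"
  by (induction I rule: infinite_finite_induct) (auto simp: pairing_add)

lemma lookup_scaleR:
  fixes p :: "'a \<Rightarrow>\<^sub>0 real"
  shows "Poly_Mapping.lookup (c *\<^sub>R p) \<alpha> = c * Poly_Mapping.lookup p \<alpha>"
proof -
  have "finite {\<alpha>. c *\<^sub>R Poly_Mapping.lookup p \<alpha> \<noteq> 0}"
    by (rule finite_subset[OF _ finite_keys[of p]]) (auto simp: in_keys_iff)
  then show ?thesis by (simp add: scaleR_poly_mapping_def Abs_poly_mapping_inverse)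
qed

lemma pairing_scaleR: "pairing (c *\<^sub>R p) w = c * pairing p w"
proof -
  have "Poly_Mapping.keys (c *\<^sub>R p) \<subseteq> Poly_Mapping.keys p"
    by (auto simp: in_keys_iff lookup_scaleR)
  then show ?thesis
    by (simp add: pairing_superset[of "Poly_Mapping.keys p"] lookup_scaleR sum_distrib_left mult.assoc)
qed

text \<open>Two finite sets of exponents contain top degree elements whose sum has only one representation.\<close>

lemma unique_top_sum:
  fixes P Q :: "('n::finite expo) set"
  assumes "finite P" "P \<noteq> {}" "finite Q" "Q \<noteq> {}"
  obtains \<alpha> \<beta> where "\<alpha> \<in> P" "\<beta> \<in> Q" "\<forall>\<alpha>'\<in>P. mdeg \<alpha>' \<le> mdeg \<alpha>" "\<forall>\<beta>'\<in>Q. mdeg \<beta>' \<le> mdeg \<beta>"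
    "\<And>\<alpha>' \<beta>'. \<alpha>' \<in> P \<Longrightarrow> \<beta>' \<in> Q \<Longrightarrow> \<alpha>' + \<beta>' = \<alpha> + \<beta> \<Longrightarrow> \<alpha>' = \<alpha> \<and> \<beta>' = \<beta>"
proof -
  define top :: "('n expo \<Rightarrow> nat) \<Rightarrow> 'n expo set \<Rightarrow> 'n expo set"
    where "top f X = {\<alpha>\<in>X. \<forall>\<alpha>'\<in>X. f \<alpha>' \<le> f \<alpha>}" for f X
  have top_ne: "top f X \<noteq> {}" if "finite X" "X \<noteq> {}" for f X
  proof -
    from that have "Max (f ` X) \<in> f ` X" by simp
    then obtain \<alpha> where "\<alpha> \<in> X" "f \<alpha> = Max (f ` X)" by auto
    with that have "\<alpha> \<in> top f X" by (auto simp: top_def)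
    then show ?thesis by blast
  qed
  define good where "good P' Q' \<longleftrightarrow> P' \<subseteq> P \<and> Q' \<subseteq> Q \<and> P' \<noteq> {} \<and> Q' \<noteq> {} \<and>
    (\<forall>\<alpha>\<in>P'. \<forall>\<beta>\<in>Q'. \<forall>\<alpha>'\<in>P. \<forall>\<beta>'\<in>Q. \<alpha>' + \<beta>' = \<alpha> + \<beta> \<longrightarrow> \<alpha>' \<in> P' \<and> \<beta>' \<in> Q')" for P' Q'
  have good_top: "good (top f P') (top f Q')"
    if "good P' Q'" and f: "\<And>\<alpha> \<beta>. f (\<alpha> + \<beta>) = f \<alpha> + f \<beta>" for f P' Q'
  proof -
    have sub: "P' \<subseteq> P" "Q' \<subseteq> Q" "P' \<noteq> {}" "Q' \<noteq> {}"
      using that(1) unfolding good_def by simp_all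
    have ne: "top f P' \<noteq> {}" "top f Q' \<noteq> {}"
      using top_ne[OF finite_subset[OF sub(1) assms(1)] sub(3)]
        top_ne[OF finite_subset[OF sub(2) assms(3)] sub(4)] by blast+
    have "\<alpha>' \<in> top f P' \<and> \<beta>' \<in> top f Q'"
      if *: "\<alpha> \<in> top f P'" "\<beta> \<in> top f Q'" "\<alpha>' \<in> P" "\<beta>' \<in> Q" "\<alpha>' + \<beta>' = \<alpha> + \<beta>" for \<alpha> \<beta> \<alpha>' \<beta>'
    proof -
      have m: "\<alpha>' \<in> P'" "\<beta>' \<in> Q'"
        using \<open>good P' Q'\<close> * unfolding good_def top_def by blast+
      have s: "f \<alpha>' + f \<beta>' = f \<alpha> + f \<beta>"
        using f[of \<alpha>' \<beta>'] f[of \<alpha> \<beta>] *(5) by simp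
      have "f \<alpha>' \<le> f \<alpha>" "f \<beta>' \<le> f \<beta>" using m * by (auto simp: top_def)
      with s have "f \<alpha>' = f \<alpha>" "f \<beta>' = f \<beta>" by linarith+
      with m * show ?thesis by (auto simp: top_def)
    qed
    moreover have "top f P' \<subseteq> P" "top f Q' \<subseteq> Q" using sub by (auto simp: top_def)
    ultimately show ?thesis using ne unfolding good_def by blast
  qed
  have "\<exists>P' Q'. good P' Q' \<and> P' \<subseteq> top mdeg P \<and> Q' \<subseteq> top mdeg Q \<and>
          (\<forall>i\<in>I. \<forall>\<alpha>\<in>P'. \<forall>\<alpha>'\<in>P'. \<alpha> $ i = \<alpha>' $ i)" if "finite I" for I :: "'n set"
    using that
  proof (induction I rule: finite_induct)
    case empty
    have "good P Q" using assms by (auto simp: good_def)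
    then have "good (top mdeg P) (top mdeg Q)" by (rule good_top) (rule mdeg_add)
    then show ?case by (intro exI[of _ "top mdeg P"] exI[of _ "top mdeg Q"]) auto
  next
    case (insert i I)
    then obtain P' Q' where *: "good P' Q'" "P' \<subseteq> top mdeg P" "Q' \<subseteq> top mdeg Q"
      "\<forall>i\<in>I. \<forall>\<alpha>\<in>P'. \<forall>\<alpha>'\<in>P'. \<alpha> $ i = \<alpha>' $ i" by blast
    let ?f = "\<lambda>\<alpha> :: 'n expo. \<alpha> $ i"
    have "good (top ?f P') (top ?f Q')" using *(1) by (rule good_top) simp
    moreover have "top ?f P' \<subseteq> P'" "top ?f Q' \<subseteq> Q'" by (auto simp: top_def)
    moreover have "\<alpha> $ i = \<alpha>' $ i" if "\<alpha> \<in> top ?f P'" "\<alpha>' \<in> top ?f P'" for \<alpha> \<alpha>'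
      using that by (auto simp: top_def intro: antisym)
    ultimately show ?case using *(2-4)
      by (intro exI[of _ "top ?f P'"] exI[of _ "top ?f Q'"]) blast
  qed
  from this[of UNIV] obtain P' Q' where *: "good P' Q'" "P' \<subseteq> top mdeg P" "Q' \<subseteq> top mdeg Q"
    "\<forall>i. \<forall>\<alpha>\<in>P'. \<forall>\<alpha>'\<in>P'. \<alpha> $ i = \<alpha>' $ i" by auto
  from *(1) have "P' \<noteq> {}" "Q' \<noteq> {}" unfolding good_def by simp_all
  then obtain \<alpha> \<beta> where ab: "\<alpha> \<in> P'" "\<beta> \<in> Q'" by blast
  show thesis
  proof (rule that[of \<alpha> \<beta>])
    fix \<alpha>' \<beta>' assume **: "\<alpha>' \<in> P" "\<beta>' \<in> Q" "\<alpha>' + \<beta>' = \<alpha> + \<beta>"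
    have "\<alpha>' \<in> P' \<and> \<beta>' \<in> Q'"
      using *(1)[unfolded good_def, THEN conjunct2, THEN conjunct2, THEN conjunct2, THEN conjunct2,
        THEN bspec, OF ab(1), THEN bspec, OF ab(2), THEN bspec, OF **(1), THEN bspec, OF **(2),
        THEN mp, OF **(3)] .
    then have "\<alpha>' \<in> P'" ..
    then have "\<alpha>' = \<alpha>" unfolding vec_eq_iff using *(4) ab(1) by blast
    with **(3) show "\<alpha>' = \<alpha> \<and> \<beta>' = \<beta>" by simp
  qed (use *(2,3) ab in \<open>auto simp: top_def\<close>)
qed

lemma mult_top:
  fixes p q :: "'n::finite rpoly"
  assumes "p \<noteq> 0" "q \<noteq> 0"
  shows "p * q \<noteq> 0 \<and> tdeg p + tdeg q \<le> tdeg (p * q)"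
proof -
  let ?P = "Poly_Mapping.keys p" and ?Q = "Poly_Mapping.keys q"
  have ne: "?P \<noteq> {}" "?Q \<noteq> {}" using assms by auto
  obtain \<alpha> \<beta> where ab: "\<alpha> \<in> ?P" "\<beta> \<in> ?Q" "\<forall>\<alpha>'\<in>?P. mdeg \<alpha>' \<le> mdeg \<alpha>" "\<forall>\<beta>'\<in>?Q. mdeg \<beta>' \<le> mdeg \<beta>"
    and uniq: "\<And>\<alpha>' \<beta>'. \<alpha>' \<in> ?P \<Longrightarrow> \<beta>' \<in> ?Q \<Longrightarrow> \<alpha>' + \<beta>' = \<alpha> + \<beta> \<Longrightarrow> \<alpha>' = \<alpha> \<and> \<beta>' = \<beta>"
    using unique_top_sum[of ?P ?Q] ne by (metis finite_keys)
  have "Poly_Mapping.lookup (p * q) (\<alpha> + \<beta>) =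
     (\<Sum>\<alpha>'\<in>?P. \<Sum>\<beta>'\<in>?Q. if \<alpha>' + \<beta>' = \<alpha> + \<beta> then Poly_Mapping.lookup p \<alpha>' * Poly_Mapping.lookup q \<beta>' else 0)"
    by (subst mult_expand[of ?P p ?Q q]) (auto simp: lookup_sum lookup_single when_def)
  also have "\<dots> = (\<Sum>\<alpha>'\<in>?P. \<Sum>\<beta>'\<in>?Q. if \<alpha>' = \<alpha> then
      (if \<beta>' = \<beta> then Poly_Mapping.lookup p \<alpha> * Poly_Mapping.lookup q \<beta> else 0) else 0)"
    by (intro sum.cong refl) (use uniq in auto)
  also have "\<dots> = (\<Sum>\<alpha>'\<in>?P. if \<alpha>' = \<alpha> then Poly_Mapping.lookup p \<alpha> * Poly_Mapping.lookup q \<beta> else 0)"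
    by (intro sum.cong refl) (use ab in auto)
  also have "\<dots> = Poly_Mapping.lookup p \<alpha> * Poly_Mapping.lookup q \<beta>"
    using ab by auto
  finally have "\<alpha> + \<beta> \<in> Poly_Mapping.keys (p * q)"
    using ab by (auto simp: in_keys_iff)
  moreover have "tdeg p \<le> mdeg \<alpha>" "tdeg q \<le> mdeg \<beta>" using ab by (auto simp: tdeg_le_iff)
  ultimately show ?thesis
    using mdeg_le_tdeg[of "\<alpha> + \<beta>" "p * q"] by (auto simp: mdeg_add)
qed

lemma tdeg_mult_le:
  fixes p q :: "'n::finite rpoly"
  shows "tdeg (p * q) \<le> tdeg p + tdeg q"
proof -
  have "mdeg \<gamma> \<le> tdeg p + tdeg q" if g: "\<gamma> \<in> Poly_Mapping.keys (p * q)" for \<gamma>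
  proof -
    from g obtain \<alpha> \<beta> where "\<gamma> = \<alpha> + \<beta>" "\<alpha> \<in> Poly_Mapping.keys p" "\<beta> \<in> Poly_Mapping.keys q"
      using keys_mult[of p q] by blast
    then show ?thesis by (simp add: mdeg_add add_mono mdeg_le_tdeg)
  qed
  then show ?thesis by (simp add: tdeg_le_iff)
qed

lemma tdeg_mult_square_le_iff:
  fixes p q :: "'n::finite rpoly"
  assumes "q \<noteq> 0" "p \<noteq> 0"
  shows "tdeg (q * p ^ 2) \<le> d \<longleftrightarrow> 2 * tdeg p + tdeg q \<le> d"
proof -
  have "tdeg q + tdeg p \<le> tdeg (q * p)" "q * p \<noteq> 0" using mult_top[OF assms] by auto
  moreover from this(2) have "tdeg (q * p) + tdeg p \<le> tdeg (q * p * p)"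
    using mult_top[of "q * p" p] assms by auto
  moreover have "tdeg (q * p * p) \<le> tdeg (q * p) + tdeg p" "tdeg (q * p) \<le> tdeg q + tdeg p"
    by (rule tdeg_mult_le)+
  moreover have "q * p ^ 2 = q * p * p" by (simp add: power2_eq_square mult.assoc)
  ultimately show ?thesis by auto
qed

theorem is_loc_matrix_iff:
  fixes q :: "'n::finite rpoly"
  shows "is_loc_matrix k q w M \<longleftrightarrow>
    M = (\<lambda>\<alpha> \<beta>. if \<alpha> \<in> loc_index k q \<and> \<beta> \<in> loc_index k q then riesz w (q * pmonom (\<alpha> + \<beta>)) else 0)"
    (is "_ \<longleftrightarrow> M = ?N")
proof -
  let ?S = "loc_index k q"
  have fin: "finite ?S" by (rule finite_loc_index)
  have expand: "riesz w (q * p ^ 2) =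
      (\<Sum>\<alpha>\<in>?S. \<Sum>\<beta>\<in>?S. Poly_Mapping.lookup p \<alpha> * riesz w (q * pmonom (\<alpha> + \<beta>)) * Poly_Mapping.lookup p \<beta>)"
    if "Poly_Mapping.keys p \<subseteq> ?S" for p
  proof -
    have "p ^ 2 = (\<Sum>\<alpha>\<in>?S. \<Sum>\<beta>\<in>?S. Poly_Mapping.single (\<alpha> + \<beta>)
           (Poly_Mapping.lookup p \<alpha> * Poly_Mapping.lookup p \<beta>))"
      unfolding power2_eq_square by (rule mult_expand[OF fin that fin that])
    also have "\<dots> = (\<Sum>\<alpha>\<in>?S. \<Sum>\<beta>\<in>?S.
          Poly_Mapping.single 0 (Poly_Mapping.lookup p \<alpha> * Poly_Mapping.lookup p \<beta>) * pmonom (\<alpha> + \<beta>))"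
      by (simp add: pmonom_def mult_single)
    finally have "q * p ^ 2 = (\<Sum>\<alpha>\<in>?S. \<Sum>\<beta>\<in>?S.
          Poly_Mapping.single 0 (Poly_Mapping.lookup p \<alpha> * Poly_Mapping.lookup p \<beta>) * (q * pmonom (\<alpha> + \<beta>)))"
      by (simp add: sum_distrib_left mult.left_commute)
    moreover have "Poly_Mapping.single 0 c * r = c *\<^sub>R r" for c and r :: "'n rpoly"
    proof (rule poly_mapping_eqI)
      fix \<gamma>
      have "Poly_Mapping.single 0 c * r = Poly_Mapping.single 0 c *
          (\<Sum>\<beta>\<in>Poly_Mapping.keys r. Poly_Mapping.single \<beta> (Poly_Mapping.lookup r \<beta>))"
        by (rule arg_cong[OF poly_expand]) simp_all
      also have "\<dots> = (\<Sum>\<beta>\<in>Poly_Mapping.keys r. Poly_Mapping.single \<beta> (c * Poly_Mapping.lookup r \<beta>))"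
        by (simp add: sum_distrib_left mult_single)
      finally have "Poly_Mapping.single 0 c * r =
          (\<Sum>\<beta>\<in>Poly_Mapping.keys r. Poly_Mapping.single \<beta> (c * Poly_Mapping.lookup r \<beta>))" .
      then show "Poly_Mapping.lookup (Poly_Mapping.single 0 c * r) \<gamma> = Poly_Mapping.lookup (c *\<^sub>R r) \<gamma>"
        by (auto simp: lookup_sum lookup_single when_def in_keys_iff lookup_scaleR)
    qed
    ultimately have "q * p ^ 2 = (\<Sum>\<alpha>\<in>?S. \<Sum>\<beta>\<in>?S.
        (Poly_Mapping.lookup p \<alpha> * Poly_Mapping.lookup p \<beta>) *\<^sub>R (q * pmonom (\<alpha> + \<beta>)))"
      by simp
    then show ?thesis
      by (simp only: pairing_sum pairing_scaleR mult_ac)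
  qed
  have inS: "Poly_Mapping.keys p \<subseteq> ?S" if "q \<noteq> 0" "tdeg (q * p ^ 2) \<le> 2 * k" for p
  proof (cases "p = 0")
    case False
    then have "2 * tdeg p + tdeg q \<le> 2 * k" using that tdeg_mult_square_le_iff by blast
    then show ?thesis using mdeg_le_tdeg[of _ p] by (fastforce simp: loc_index_def)
  qed simp
  have N: "is_loc_matrix k q w ?N"
  proof -
    have "riesz w (q * p ^ 2) =
       (\<Sum>\<alpha>\<in>?S. \<Sum>\<beta>\<in>?S. Poly_Mapping.lookup p \<alpha> * ?N \<alpha> \<beta> * Poly_Mapping.lookup p \<beta>)"
      if "tdeg (q * p ^ 2) \<le> 2 * k" for p
    proof (cases "q = 0")
      case False
      show ?thesis by (subst expand[OF inS[OF False that]]) (auto intro!: sum.cong)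
    qed simp
    then show ?thesis by (auto simp: is_loc_matrix_def add.commute)
  qed
  have "M = M'" if M: "is_loc_matrix k q w M" and M': "is_loc_matrix k q w M'" for M M'
  proof (intro ext)
    fix \<alpha> \<beta>
    define D where "D \<alpha> \<beta> = M \<alpha> \<beta> - M' \<alpha> \<beta>" for \<alpha> \<beta>
    have sym: "D \<alpha> \<beta> = D \<beta> \<alpha>" for \<alpha> \<beta>
      unfolding D_def using M M' by (metis is_loc_matrix_def)
    have quad: "(\<Sum>\<alpha>\<in>?S. \<Sum>\<beta>\<in>?S. Poly_Mapping.lookup p \<alpha> * D \<alpha> \<beta> * Poly_Mapping.lookup p \<beta>) = 0"
      if "Poly_Mapping.keys p \<subseteq> ?S" for p
    proof -
      have deg: "tdeg (q * p ^ 2) \<le> 2 * k"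
      proof (cases "q = 0 \<or> p = 0")
        case True
        then show ?thesis by (auto simp: tdeg_le_iff)
      next
        case False
        then obtain \<gamma> where "\<gamma> \<in> Poly_Mapping.keys p" by fastforce
        with that have "tdeg q \<le> 2 * k" by (auto simp: loc_index_def)
        moreover have "tdeg p \<le> (2 * k - tdeg q) div 2"
          unfolding tdeg_le_iff[of p]
        proof
          fix \<delta> assume "\<delta> \<in> Poly_Mapping.keys p"
          with that have "2 * mdeg \<delta> + tdeg q \<le> 2 * k" by (auto simp: loc_index_def)
          then show "mdeg \<delta> \<le> (2 * k - tdeg q) div 2" by linarith
        qed
        ultimately have "2 * tdeg p + tdeg q \<le> 2 * k" by linarith
        then show ?thesis using False tdeg_mult_square_le_iff by blast
      qed
      have form: "riesz w (q * p ^ 2) =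
          (\<Sum>\<alpha>\<in>?S. \<Sum>\<beta>\<in>?S. Poly_Mapping.lookup p \<alpha> * X \<alpha> \<beta> * Poly_Mapping.lookup p \<beta>)"
        if "is_loc_matrix k q w X" for X
        using that deg unfolding is_loc_matrix_def by simp
      have "(\<Sum>\<alpha>\<in>?S. \<Sum>\<beta>\<in>?S. Poly_Mapping.lookup p \<alpha> * M \<alpha> \<beta> * Poly_Mapping.lookup p \<beta>) =
          (\<Sum>\<alpha>\<in>?S. \<Sum>\<beta>\<in>?S. Poly_Mapping.lookup p \<alpha> * M' \<alpha> \<beta> * Poly_Mapping.lookup p \<beta>)"
        using form[OF M] form[OF M'] by simp
      then show ?thesis
        by (simp add: D_def algebra_simps sum_subtractf)
    qed
    have ev: "(\<Sum>\<gamma>\<in>?S. \<Sum>\<delta>\<in>?S. (if \<gamma> = \<alpha> then 1 else 0) * D \<gamma> \<delta> * (if \<delta> = \<beta> then 1 else 0)) = D \<alpha> \<beta>"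
      if "\<alpha> \<in> ?S" "\<beta> \<in> ?S" for \<alpha> \<beta>
    proof -
      have "(\<Sum>\<gamma>\<in>?S. \<Sum>\<delta>\<in>?S. (if \<gamma> = \<alpha> then 1 else 0) * D \<gamma> \<delta> * (if \<delta> = \<beta> then 1 else 0)) =
        (\<Sum>\<gamma>\<in>?S. if \<gamma> = \<alpha> then (\<Sum>\<delta>\<in>?S. if \<delta> = \<beta> then D \<gamma> \<delta> else 0) else 0)"
        by (intro sum.cong refl) (auto intro!: sum.cong)
      then show ?thesis using that fin by simp
    qed
    have diag: "D \<alpha> \<alpha> = 0" if "\<alpha> \<in> ?S" for \<alpha>
    proof -
      have "Poly_Mapping.keys (pmonom \<alpha>) \<subseteq> ?S" using that by (simp add: pmonom_def)
      from quad[OF this] ev[OF that that] show ?thesis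
        by (simp add: pmonom_def lookup_single when_def eq_commute[of \<alpha>])
    qed
    have "D \<alpha> \<beta> = 0"
    proof (cases "\<alpha> \<in> ?S \<and> \<beta> \<in> ?S")
      case True
      let ?p = "pmonom \<alpha> + pmonom \<beta>"
      have "Poly_Mapping.keys ?p \<subseteq> ?S"
        using Poly_Mapping.keys_add[of "pmonom \<alpha>" "pmonom \<beta>"] True by (auto simp: pmonom_def)
      moreover have "Poly_Mapping.lookup ?p = (\<lambda>\<gamma>. (if \<gamma> = \<alpha> then 1 else 0) + (if \<gamma> = \<beta> then 1 else 0))"
        by (auto simp: fun_eq_iff pmonom_def lookup_add lookup_single when_def)
      ultimately have "D \<alpha> \<alpha> + D \<beta> \<alpha> + (D \<alpha> \<beta> + D \<beta> \<beta>) = 0"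
        using quad[of ?p] True
        by (simp only: distrib_left distrib_right sum.distrib ev simp_thms)
      then show ?thesis using diag True sym[of \<alpha> \<beta>] by simp
    next
      case False
      then have "X \<alpha> \<beta> = 0" if "is_loc_matrix k q w X" for X
        using that unfolding is_loc_matrix_def by blast
      from this[OF M] this[OF M'] show ?thesis by (simp add: D_def)
    qed
    then show "M \<alpha> \<beta> = M' \<alpha> \<beta>" by (simp add: D_def)
  qed
  with N show ?thesis by blast
qed

corollary loc_matrix_eq:
  "loc_matrix k q w =
    (\<lambda>\<alpha> \<beta>. if \<alpha> \<in> loc_index k q \<and> \<beta> \<in> loc_index k q then riesz w (q * pmonom (\<alpha> + \<beta>)) else 0)"
  unfolding loc_matrix_def is_loc_matrix_iff by simp

corollary loc_matrix_spec: "is_loc_matrix k q w (loc_matrix k q w)"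
  by (simp add: is_loc_matrix_iff loc_matrix_eq)

end

theory Submission
  imports Defs
begin

text \<open>
  Part (i) rests on two facts. A truncated moment vector of an arbitrary, possibly infinite, measure
  is a conic combination of point evaluations (Richter, Tchakaloff), and point evaluations have
  moments of every order. Pairing with a feasible pseudo-moment vector is nonnegative on the
  truncated quadratic module and zero on the truncated ideal.

  For part (ii), infeasibility means that \<open>b\<close> lies outside the cone generated by the points
  \<open>(a\<^sub>1(x), \<dots>, a\<^sub>m(x))\<close> with \<open>x \<in> K\<close>. Since \<open>K\<close> is compact and some combination of the \<open>a\<^sub>i\<close> is
  positive on \<open>K\<close>, the point \<open>b\<close> is separated from the cone by some \<open>\<lambda>\<close> with \<open>\<Sum> \<lambda>\<^sub>i a\<^sub>i > 0\<close> on \<open>K\<close>,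
  and Putinar's Positivstellensatz turns this positivity into membership in \<open>I(h) + Q(g)\<close>.

  Putinar's theorem is obtained algebraically: a maximal proper quadratic module containing an
  archimedean one is a total preorder whose associated functional is a ring homomorphism, that is,
  evaluation at a point of \<open>K\<close>. Separation in finite dimension uses the same construction of a
  functional from a maximal cone.
\<close>

section \<open>Maximal cones and their functionals\<close>

text \<open>The set \<open>T\<close> of unary operations is a parameter so that one application of
  Zorn's lemma serves twice: multiplications by squares give quadratic modules, nonnegative scalings
  give convex cones.\<close>

definition stable_submonoid :: "('v \<Rightarrow> 'v) set \<Rightarrow> 'v::comm_monoid_add set \<Rightarrow> bool"
  where "stable_submonoid T D \<longleftrightarrow>
    0 \<in> D \<and> (\<forall>v\<in>D. \<forall>w\<in>D. v + w \<in> D) \<and> (\<forall>t\<in>T. \<forall>v\<in>D. t v \<in> D)"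

lemma stable_submonoidD:
  assumes "stable_submonoid T D"
  shows "0 \<in> D" "\<And>v w. v \<in> D \<Longrightarrow> w \<in> D \<Longrightarrow> v + w \<in> D" "\<And>t v. t \<in> T \<Longrightarrow> v \<in> D \<Longrightarrow> t v \<in> D"
  using assms by (auto simp: stable_submonoid_def)

lemma stable_submonoid_sum:
  assumes "stable_submonoid T D" "\<And>i. i \<in> I \<Longrightarrow> f i \<in> D"
  shows "(\<Sum>i\<in>I. f i) \<in> D"
  using assms(2) by (induction I rule: infinite_finite_induct) (auto intro: stable_submonoidD[OF assms(1)])

text \<open>Zorn's lemma applies because each closure condition involves at most two elements, and
  two elements of the union of a chain already lie in one member of the chain.\<close>

lemma maximal_stable_submonoid:
  assumes "stable_submonoid T C" "y \<notin> C"
  obtains D where "stable_submonoid T D" "C \<subseteq> D" "y \<notin> D"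
    "\<And>D'. stable_submonoid T D' \<Longrightarrow> D \<subseteq> D' \<Longrightarrow> y \<notin> D' \<Longrightarrow> D' = D"
proof -
  let ?F = "{D. stable_submonoid T D \<and> C \<subseteq> D \<and> y \<notin> D}"
  have "\<exists>M\<in>?F. \<forall>X\<in>?F. M \<subseteq> X \<longrightarrow> X = M"
  proof (rule subset_Zorn_nonempty)
    show "?F \<noteq> {}" using assms by auto
  next
    fix \<C> assume ne: "\<C> \<noteq> {}" and ch: "subset.chain ?F \<C>"
    then have mem: "stable_submonoid T X" "C \<subseteq> X" "y \<notin> X" if "X \<in> \<C>" for X
      using that by (auto simp: subset_chain_def)
    have "v + w \<in> \<Union>\<C>" if "v \<in> \<Union>\<C>" "w \<in> \<Union>\<C>" for v w
    proof -
      from that obtain X Y where XY: "X \<in> \<C>" "Y \<in> \<C>" "v \<in> X" "w \<in> Y" by blast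
      then have "X \<subseteq> Y \<or> Y \<subseteq> X" using ch by (auto simp: subset_chain_def)
      then show ?thesis
        using XY stable_submonoidD(2)[OF mem(1)] by (metis UnionI subsetD)
    qed
    moreover have "t v \<in> \<Union>\<C>" if "t \<in> T" "v \<in> \<Union>\<C>" for t v
      using that stable_submonoidD(3)[OF mem(1)] by blast
    moreover have "0 \<in> \<Union>\<C>" using ne stable_submonoidD(1)[OF mem(1)] by blast
    moreover have "C \<subseteq> \<Union>\<C>" "y \<notin> \<Union>\<C>" using mem(2,3) ne by blast+
    ultimately show "\<Union>\<C> \<in> ?F"
      unfolding stable_submonoid_def by blast
  qed
  then obtain D where "D \<in> ?F" and max: "\<forall>X\<in>?F. D \<subseteq> X \<longrightarrow> X = D" by blast
  then show thesis by (intro that[of D]) auto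
qed

text \<open>The value at \<open>v\<close> is a Dedekind cut: the place of \<open>v\<close> among the
  multiples of \<open>u\<close> in the preorder defined by \<open>D\<close>. Condition
  \<open>unit\<close>, used for \<open>v\<close> and \<open>- v\<close>, bounds the cut, totality
  leaves no gap, and \<open>- u \<notin> D\<close> makes the value unique.\<close>

lemma total_cone_functional:
  fixes D E :: "'v::real_vector set"
  assumes E: "subspace E" and u: "u \<in> E" "- u \<notin> D"
    and add: "\<And>v w. v \<in> D \<Longrightarrow> w \<in> D \<Longrightarrow> v + w \<in> D"
    and scale: "\<And>c v. 0 \<le> c \<Longrightarrow> v \<in> D \<Longrightarrow> c *\<^sub>R v \<in> D"
    and total: "\<And>v. v \<in> E \<Longrightarrow> v \<in> D \<or> - v \<in> D"
    and unit: "\<And>v. v \<in> E \<Longrightarrow> \<exists>c. c *\<^sub>R u - v \<in> D"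
  obtains l :: "'v \<Rightarrow> real" where
    "\<And>v w. v \<in> E \<Longrightarrow> w \<in> E \<Longrightarrow> l (v + w) = l v + l w"
    "\<And>c v. v \<in> E \<Longrightarrow> l (c *\<^sub>R v) = c * l v"
    "\<And>v. v \<in> E \<Longrightarrow> v \<in> D \<Longrightarrow> 0 \<le> l v"
    "l u = 1"
proof -
  \<comment> \<open>The slack \<open>e\<close> is there because \<open>D\<close> need not be closed:
    \<open>v - t *\<^sub>R u\<close> may lie outside \<open>D\<close> for the correct value
    \<open>t\<close>.\<close>
  define P where "P v t \<longleftrightarrow> (\<forall>e>0. v - (t - e) *\<^sub>R u \<in> D \<and> (t + e) *\<^sub>R u - v \<in> D)" for v t
  have uD: "u \<in> D" using total[OF u(1)] u(2) by blast
  have nonneg: "0 \<le> c" if "c *\<^sub>R u \<in> D" for c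
  proof (rule ccontr)
    assume c: "\<not> 0 \<le> c"
    with that have "(- 1 / c) *\<^sub>R c *\<^sub>R u \<in> D" by (intro scale that) (auto simp: field_simps)
    with c u(2) show False by simp
  qed
  have ex: "\<exists>t. P v t" if v: "v \<in> E" for v
  proof -
    define S where "S = {r. v - r *\<^sub>R u \<in> D}"
    from unit[OF v] obtain c where c: "c *\<^sub>R u - v \<in> D" ..
    have "- v \<in> E" using v E by (simp add: subspace_neg)
    from unit[OF this] obtain d where "d *\<^sub>R u - (- v) \<in> D" ..
    then have ne: "- d \<in> S" by (simp add: S_def algebra_simps)
    have bdd: "r \<le> c" if "r \<in> S" for r
    proof -
      have "(v - r *\<^sub>R u) + (c *\<^sub>R u - v) \<in> D" using that c by (intro add) (auto simp: S_def)
      then have "(c - r) *\<^sub>R u \<in> D" by (simp add: algebra_simps)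
      from nonneg[OF this] show ?thesis by simp
    qed
    then have bdd': "bdd_above S" by (rule bdd_aboveI)
    have "P v (Sup S)" unfolding P_def
    proof (intro allI impI conjI)
      fix e :: real assume e: "0 < e"
      then obtain r where r: "r \<in> S" "Sup S - e < r"
        using less_cSup_iff[of S "Sup S - e"] bdd' ne by auto
      have "(v - r *\<^sub>R u) + (r - (Sup S - e)) *\<^sub>R u \<in> D"
        using r uD by (intro add scale) (auto simp: S_def)
      then show "v - (Sup S - e) *\<^sub>R u \<in> D" by (simp add: algebra_simps)
      have "Sup S + e \<notin> S" using cSup_upper[OF _ bdd', of "Sup S + e"] e by auto
      moreover have "v - (Sup S + e) *\<^sub>R u \<in> E" using v u E by (simp add: subspace_diff subspace_scale)
      ultimately show "(Sup S + e) *\<^sub>R u - v \<in> D" using total by (fastforce simp: S_def)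
    qed
    then show ?thesis ..
  qed
  have uniq: "t = s" if "P v t" "P v s" for v t s
  proof -
    have "\<not> t < s" if "P v t" "P v s" for t s
    proof
      assume "t < s"
      \<comment> \<open>With a third of the gap as slack, adding the two memberships puts
        \<open>- e *\<^sub>R u\<close> into \<open>D\<close>.\<close>
      define e where "e = (s - t) / 3"
      have e: "0 < e" using \<open>t < s\<close> by (simp add: e_def)
      with that have "v - (s - e) *\<^sub>R u \<in> D" "(t + e) *\<^sub>R u - v \<in> D" by (auto simp: P_def)
      from add[OF this] have "((t + e) - (s - e)) *\<^sub>R u \<in> D"
        unfolding scaleR_diff_left[of "t + e"] by simp
      from nonneg[OF this] show False using \<open>t < s\<close> by (simp add: e_def field_simps)
    qed
    with that show ?thesis by (meson linorder_neqE)
  qed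
  define l where "l v = (THE t. P v t)" for v
  have l: "l v = t" if "P v t" for v t
    unfolding l_def using that uniq by blast
  have Pl: "P v (l v)" if v: "v \<in> E" for v
    using ex[OF v] l by auto
  show thesis
  proof (rule that[of l])
    fix v w assume "v \<in> E" "w \<in> E"
    then have P: "P v (l v)" "P w (l w)" by (auto intro: Pl)
    have "P (v + w) (l v + l w)" unfolding P_def
    proof (intro allI impI conjI)
      fix e :: real assume "0 < e"
      then have *: "v - (l v - e / 2) *\<^sub>R u \<in> D" "(l v + e / 2) *\<^sub>R u - v \<in> D"
        "w - (l w - e / 2) *\<^sub>R u \<in> D" "(l w + e / 2) *\<^sub>R u - w \<in> D"
        using P by (auto simp: P_def)
      have "e *\<^sub>R u = (e / 2) *\<^sub>R u + (e / 2) *\<^sub>R u" by (simp flip: scaleR_add_left)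
      then show "v + w - (l v + l w - e) *\<^sub>R u \<in> D" "(l v + l w + e) *\<^sub>R u - (v + w) \<in> D"
        using add[OF *(1,3)] add[OF *(2,4)] by (simp_all add: algebra_simps)
    qed
    then show "l (v + w) = l v + l w" by (rule l)
  next
    fix c v assume "v \<in> E"
    then have P: "P v (l v)" by (rule Pl)
    have "P (c *\<^sub>R v) (c * l v)" unfolding P_def
    proof (intro allI impI)
      fix e :: real assume e: "0 < e"
      \<comment> \<open>The tolerance for \<open>v\<close> that becomes \<open>e\<close> after
        scaling by the absolute value of \<open>c\<close>; for \<open>c = 0\<close> any positive
        number will do.\<close>
      define d where "d = (if c = 0 then 1 else e / \<bar>c\<bar>)"
      have d: "d > 0" "\<bar>c\<bar> * d = (if c = 0 then 0 else e)" using e by (auto simp: d_def)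
      have *: "v - (l v - d) *\<^sub>R u \<in> D" "(l v + d) *\<^sub>R u - v \<in> D"
        using P d by (auto simp: P_def)
      have "\<bar>c\<bar> *\<^sub>R (v - (l v - d) *\<^sub>R u) = \<bar>c\<bar> *\<^sub>R v - (\<bar>c\<bar> * l v - (if c = 0 then 0 else e)) *\<^sub>R u"
        "\<bar>c\<bar> *\<^sub>R ((l v + d) *\<^sub>R u - v) = (\<bar>c\<bar> * l v + (if c = 0 then 0 else e)) *\<^sub>R u - \<bar>c\<bar> *\<^sub>R v"
        using d(2) by (simp_all add: scaleR_diff_right algebra_simps)
      with scale[OF abs_ge_zero *(1), of c] scale[OF abs_ge_zero *(2), of c]
      have **: "\<bar>c\<bar> *\<^sub>R v - (\<bar>c\<bar> * l v - (if c = 0 then 0 else e)) *\<^sub>R u \<in> D"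
        "(\<bar>c\<bar> * l v + (if c = 0 then 0 else e)) *\<^sub>R u - \<bar>c\<bar> *\<^sub>R v \<in> D" by simp_all
      consider "c = 0" | "c > 0" | "c < 0" by linarith
      then show "c *\<^sub>R v - (c * l v - e) *\<^sub>R u \<in> D \<and> (c * l v + e) *\<^sub>R u - c *\<^sub>R v \<in> D"
      proof cases
        case 1
        then show ?thesis using scale[OF _ uD, of e] e by simp
      next
        case 2
        then show ?thesis using ** by simp
      next
        case 3
        then show ?thesis using ** by (simp add: algebra_simps)
      qed
    qed
    then show "l (c *\<^sub>R v) = c * l v" by (rule l)
  next
    fix v assume v: "v \<in> E" "v \<in> D"
    show "0 \<le> l v"
    proof (rule field_le_epsilon)
      fix e :: real assume "0 < e"
      with Pl[OF v(1)] have "(l v + e) *\<^sub>R u - v \<in> D" by (simp add: P_def)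
      from add[OF this v(2)] nonneg show "0 \<le> l v + e" by simp
    qed
  next
    have "P u 1" using scale[OF _ uD] by (auto simp: P_def algebra_simps)
    then show "l u = 1" by (rule l)
  qed
qed


section \<open>Quadratic modules in commutative real algebras\<close>

definition sum_squares :: "'a::comm_ring_1 set"
  where "sum_squares = {sum_list (map (\<lambda>p. p ^ 2) ps) | ps. True}"

definition quadratic_module :: "'a::comm_ring_1 set \<Rightarrow> bool"
  where "quadratic_module M \<longleftrightarrow> 1 \<in> M \<and> stable_submonoid (range (\<lambda>q p. q ^ 2 * p)) M"

text \<open>Upper bounds for all \<open>p\<close> include lower bounds, by passing to
  \<open>- p\<close>: the constant 1 is an order unit. That the ball condition
  \<open>archimedean\<close> leads to this form is shown with the help of
  \<open>bounded_elements\<close>.\<close>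

definition archimedean_module :: "'a::{comm_ring_1,real_algebra_1} set \<Rightarrow> bool"
  where "archimedean_module M \<longleftrightarrow> (\<forall>p. \<exists>r. of_real r - p \<in> M)"

definition real_character :: "('a::{comm_ring_1,real_algebra_1} \<Rightarrow> real) \<Rightarrow> bool"
  where "real_character \<phi> \<longleftrightarrow> \<phi> 1 = 1 \<and> (\<forall>p q. \<phi> (p + q) = \<phi> p + \<phi> q) \<and>
    (\<forall>p q. \<phi> (p * q) = \<phi> p * \<phi> q) \<and> (\<forall>c p. \<phi> (c *\<^sub>R p) = c * \<phi> p)"

section \<open>Sums of squares and closure properties of quadratic modules\<close>

lemma zero_in_sum_squares: "0 \<in> sum_squares"
  unfolding sum_squares_def by (auto intro!: exI[of _ "[]"])

lemma square_in_sum_squares: "p ^ 2 \<in> sum_squares"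
  unfolding sum_squares_def by (auto intro!: exI[of _ "[p]"])

lemma add_in_sum_squares: "s \<in> sum_squares \<Longrightarrow> t \<in> sum_squares \<Longrightarrow> s + t \<in> sum_squares"
  unfolding sum_squares_def
proof clarify
  fix ps qs :: "'a list"
  show "\<exists>rs. (\<Sum>p\<leftarrow>ps. p\<^sup>2) + (\<Sum>p\<leftarrow>qs. p\<^sup>2) = (\<Sum>p\<leftarrow>rs. p\<^sup>2) \<and> True"
    by (rule exI[of _ "ps @ qs"]) simp
qed

lemma sum_squares_induct [consumes 1, case_names zero add]:
  assumes "s \<in> sum_squares" "P 0" "\<And>p s. s \<in> sum_squares \<Longrightarrow> P s \<Longrightarrow> P (p ^ 2 + s)"
  shows "P s"
proof -
  have "P (\<Sum>p\<leftarrow>ps. p\<^sup>2)" for ps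
    by (induction ps) (auto intro!: assms(2,3) simp: sum_squares_def)
  with assms(1) show ?thesis by (auto simp: sum_squares_def)
qed

lemma quadratic_moduleI:
  assumes "1 \<in> M" "\<And>p q. p \<in> M \<Longrightarrow> q \<in> M \<Longrightarrow> p + q \<in> M" "\<And>p q. p \<in> M \<Longrightarrow> q ^ 2 * p \<in> M"
  shows "quadratic_module M"
  using assms assms(3)[of 1 0] by (auto simp: quadratic_module_def stable_submonoid_def)

lemma square_mult_in_sum_squares: "s \<in> sum_squares \<Longrightarrow> q ^ 2 * s \<in> sum_squares"
proof (induction s rule: sum_squares_induct)
  case (add p s)
  then show ?case
    using add_in_sum_squares[OF square_in_sum_squares[of "q * p"]] by (simp add: power_mult_distrib distrib_left)
qed (simp add: zero_in_sum_squares)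

lemma quadratic_moduleD:
  assumes "quadratic_module M"
  shows "1 \<in> M" "0 \<in> M" "\<And>p q. p \<in> M \<Longrightarrow> q \<in> M \<Longrightarrow> p + q \<in> M" "\<And>p q. p \<in> M \<Longrightarrow> q ^ 2 * p \<in> M"
  using assms stable_submonoidD(3)[of "range (\<lambda>q p. q ^ 2 * p)" M "\<lambda>p. q ^ 2 * p" for q]
  by (auto simp: quadratic_module_def stable_submonoid_def)

lemma quadratic_module_sos_mult:
  assumes "quadratic_module M" "s \<in> sum_squares" "p \<in> M"
  shows "s * p \<in> M"
  using assms(2) by (induction s rule: sum_squares_induct)
    (auto simp: distrib_right intro: quadratic_moduleD[OF assms(1)] assms(3))

lemma quadratic_module_sos:
  assumes "quadratic_module M" "s \<in> sum_squares"
  shows "s \<in> M"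
  using quadratic_module_sos_mult[OF assms quadratic_moduleD(1)[OF assms(1)]] by simp

lemma quadratic_module_square:
  assumes "quadratic_module M"
  shows "p ^ 2 \<in> M"
  by (rule quadratic_module_sos[OF assms square_in_sum_squares])

text \<open>A nonnegative real is the square of its root, so scaling is multiplication by a square
  of the algebra.\<close>

lemma quadratic_module_scaleR:
  fixes M :: "'a::{comm_ring_1,real_algebra_1} set"
  assumes "quadratic_module M" "p \<in> M" "0 \<le> c"
  shows "c *\<^sub>R p \<in> M"
proof -
  have "of_real (sqrt c) ^ 2 * p \<in> M" by (rule quadratic_moduleD(4)[OF assms(1,2)])
  then show ?thesis using assms(3) by (simp add: scaleR_conv_of_real flip: of_real_power)
qed

lemma quadratic_module_of_real:
  fixes M :: "'a::{comm_ring_1,real_algebra_1} set"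
  assumes "quadratic_module M" "0 \<le> c"
  shows "of_real c \<in> M"
  using quadratic_module_scaleR[OF assms(1) quadratic_moduleD(1)[OF assms(1)] assms(2)]
  by (simp add: of_real_def)

text \<open>
  A quadratic module need not be closed under products, but a product of the two factors
  \<open>c - p\<close> and \<open>c + p\<close> is reached through
  \<open>2c(c\<^sup>2 - p\<^sup>2) = (c - p)\<^sup>2(c + p) + (c + p)\<^sup>2(c - p)\<close>.
\<close>

lemma quadratic_module_bounded_square:
  fixes M :: "'a::{comm_ring_1,real_algebra_1} set"
  assumes M: "quadratic_module M" and c: "0 < c"
    and p: "of_real c - p \<in> M" "of_real c + p \<in> M"
  shows "of_real (c ^ 2) - p ^ 2 \<in> M"
proof -
  have "(of_real c - p) ^ 2 * (of_real c + p) + (of_real c + p) ^ 2 * (of_real c - p) \<in> M"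
    by (rule quadratic_moduleD(3,4)[OF M] p)+
  then have "(1 / (2 * c)) *\<^sub>R ((of_real c - p) ^ 2 * (of_real c + p) + (of_real c + p) ^ 2 * (of_real c - p)) \<in> M"
    using c by (intro quadratic_module_scaleR[OF M]) auto
  moreover have "(of_real c - p) ^ 2 * (of_real c + p) + (of_real c + p) ^ 2 * (of_real c - p) =
      (2 * c) *\<^sub>R (of_real (c ^ 2) - p ^ 2)"
    by (simp add: scaleR_conv_of_real power2_eq_square algebra_simps)
  ultimately show ?thesis using c by simp
qed

text \<open>Polarization: \<open>4qp = (q + 1)^2 p + (q - 1)^2 (- p)\<close>. Thus the elements of
  \<open>M\<close> whose negatives are in \<open>M\<close> form an ideal.\<close>

lemma ideal_support:
  fixes M :: "'a::{comm_ring_1,real_algebra_1} set"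
  assumes M: "quadratic_module M" and p: "p \<in> M" "- p \<in> M"
  shows "q * p \<in> M"
proof -
  have "(1/4) *\<^sub>R ((q + 1) ^ 2 * p + (q - 1) ^ 2 * (- p)) \<in> M"
    using p by (intro quadratic_moduleD[OF M] quadratic_module_scaleR[OF M]) auto
  moreover have "(q + 1) ^ 2 * p + (q - 1) ^ 2 * (- p) = 4 *\<^sub>R (q * p)"
    by (simp add: scaleR_conv_of_real power2_eq_square algebra_simps)
  ultimately show ?thesis by simp
qed

lemma quadratic_module_adjoin:
  assumes M: "quadratic_module M"
  shows "quadratic_module {m + a * s | m s. m \<in> M \<and> s \<in> sum_squares}"
proof (rule quadratic_moduleI)
  show "1 \<in> {m + a * s | m s. m \<in> M \<and> s \<in> sum_squares}"
    using quadratic_moduleD(1)[OF M] zero_in_sum_squares by force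
next
  fix p q assume "p \<in> {m + a * s | m s. m \<in> M \<and> s \<in> sum_squares}" "q \<in> {m + a * s | m s. m \<in> M \<and> s \<in> sum_squares}"
  then obtain m s m' s' where "p = m + a * s" "q = m' + a * s'" "m \<in> M" "m' \<in> M" "s \<in> sum_squares" "s' \<in> sum_squares"
    by blast
  then have "p + q = (m + m') + a * (s + s')" "m + m' \<in> M" "s + s' \<in> sum_squares"
    using quadratic_moduleD(3)[OF M] add_in_sum_squares by (auto simp: algebra_simps)
  then show "p + q \<in> {m + a * s | m s. m \<in> M \<and> s \<in> sum_squares}" by blast
next
  fix p q assume "p \<in> {m + a * s | m s. m \<in> M \<and> s \<in> sum_squares}"
  then obtain m s where "p = m + a * s" "m \<in> M" "s \<in> sum_squares" by blast
  then have "q ^ 2 * p = q ^ 2 * m + a * (q ^ 2 * s)" "q ^ 2 * m \<in> M" "q ^ 2 * s \<in> sum_squares"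
    using quadratic_moduleD(4)[OF M] square_mult_in_sum_squares by (auto simp: algebra_simps)
  then show "q ^ 2 * p \<in> {m + a * s | m s. m \<in> M \<and> s \<in> sum_squares}" by blast
qed

text \<open>If \<open>a\<close> and \<open>- a\<close> were both missing, adjoining either would
  produce \<open>- 1\<close>. The two resulting identities combine to put \<open>- 1\<close> into
  \<open>M\<close> itself.\<close>

lemma maximal_quadratic_module_total:
  fixes M :: "'a::{comm_ring_1,real_algebra_1} set"
  assumes M: "quadratic_module M" "- 1 \<notin> M"
    and max: "\<And>N. quadratic_module N \<Longrightarrow> M \<subseteq> N \<Longrightarrow> - 1 \<notin> N \<Longrightarrow> N = M"
  shows "a \<in> M \<or> - a \<in> M"
proof (rule ccontr)
  assume a: "\<not> (a \<in> M \<or> - a \<in> M)"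
  have *: "\<exists>m s. m \<in> M \<and> s \<in> sum_squares \<and> - 1 = m + a * s" if "a \<notin> M" for a
  proof -
    let ?N = "{m + a * s | m s. m \<in> M \<and> s \<in> sum_squares}"
    have "a \<in> ?N" using quadratic_moduleD(2)[OF M(1)] square_in_sum_squares[of 1] by force
    moreover have "M \<subseteq> ?N" using zero_in_sum_squares by force
    ultimately have "- 1 \<in> ?N" using max[OF quadratic_module_adjoin[OF M(1)], of a] that by auto
    then show ?thesis by blast
  qed
  from *[of a] a obtain m s where ms: "m \<in> M" "s \<in> sum_squares" "- 1 = m + a * s" by blast
  from *[of "- a"] a obtain n t where nt: "n \<in> M" "t \<in> sum_squares" "- 1 = n + (- a) * t" by blast
  \<comment> \<open>Weighting the two identities by \<open>t\<close> and \<open>s\<close> cancels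
    \<open>a\<close>. The outcome places \<open>- s\<close> in \<open>M\<close> beside
    \<open>s\<close>, so that \<open>ideal_support\<close> yields
    \<open>a * s \<in> M\<close>.\<close>
  have "- s = t + (t * m + s * n)"
  proof -
    have "t * (- 1) + s * (- 1) = t * (m + a * s) + s * (n + (- a) * t)"
      by (simp only: flip: ms(3) nt(3))
    then show ?thesis by (simp add: algebra_simps eq_neg_iff_add_eq_0)
  qed
  moreover have "t + (t * m + s * n) \<in> M"
    by (rule quadratic_moduleD(3)[OF M(1)] quadratic_module_sos_mult[OF M(1)] quadratic_module_sos[OF M(1)]
        ms(1,2) nt(1,2) | assumption)+
  ultimately have "- s \<in> M" by simp
  then have "a * s \<in> M" by (intro ideal_support[OF M(1)] quadratic_module_sos[OF M(1) ms(2)])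
  then have "m + a * s \<in> M" using ms(1) by (intro quadratic_moduleD(3)[OF M(1)])
  with ms(3) M(2) show False by simp
qed

text \<open>Additivity and homogeneity come from \<open>total_cone_functional\<close>;
  multiplicativity needs an argument. If \<open>v\<close> has value 0, totality puts
  \<open>e + v\<close> and \<open>e - v\<close> in \<open>M\<close> for all \<open>e > 0\<close>, so
  \<open>e^2 - v^2\<close> is in \<open>M\<close> and \<open>v^2\<close> has value 0. Subtracting
  its value from a general \<open>v\<close> shows that squares are respected, and polarization gives
  products.\<close>

lemma character_of_maximal_module:
  fixes M :: "'a::{comm_ring_1,real_algebra_1} set"
  assumes M: "quadratic_module M" "- 1 \<notin> M" and arch: "archimedean_module M"
    and total: "\<And>a. a \<in> M \<or> - a \<in> M"
  obtains \<phi> where "real_character \<phi>" "\<And>p. p \<in> M \<Longrightarrow> 0 \<le> \<phi> p"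
proof -
  obtain \<phi> :: "'a \<Rightarrow> real" where \<phi>: "\<And>v w. \<phi> (v + w) = \<phi> v + \<phi> w" "\<And>c v. \<phi> (c *\<^sub>R v) = c * \<phi> v"
    "\<And>v. v \<in> M \<Longrightarrow> 0 \<le> \<phi> v" "\<phi> 1 = 1"
  proof (rule total_cone_functional[of UNIV 1 M])
    fix v :: 'a
    from arch obtain c where "of_real c - v \<in> M" unfolding archimedean_module_def by blast
    then show "\<exists>c. c *\<^sub>R 1 - v \<in> M" by (auto simp: of_real_def)
  qed (use M total in \<open>auto intro: quadratic_moduleD[OF M(1)] quadratic_module_scaleR[OF M(1)]\<close>)
  have of_real: "\<phi> (of_real c) = c" for c by (simp add: of_real_def \<phi>)
  have minus: "\<phi> (- v) = - \<phi> v" for v using \<phi>(2)[of "- 1" v] by simp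
  have diff: "\<phi> (v - w) = \<phi> v - \<phi> w" for v w using \<phi>(1)[of v "- w"] by (simp add: minus)
  have sq0: "\<phi> (v ^ 2) = 0" if v: "\<phi> v = 0" for v
  proof -
    have "\<phi> (v ^ 2) \<le> e ^ 2" if e: "0 < e" for e
    proof -
      have "of_real e + w \<in> M" if "\<phi> w = 0" for w
      proof -
        have "\<phi> (- (of_real e + w)) < 0" using e that by (simp only: minus \<phi>(1) of_real)
        then show ?thesis using total[of "of_real e + w"] \<phi>(3) by fastforce
      qed
      from this[of "- v"] this[of v] have "of_real (e ^ 2) - v ^ 2 \<in> M"
        using e v by (intro quadratic_module_bounded_square[OF M(1)]) (auto simp: minus)
      from \<phi>(3)[OF this] show ?thesis by (simp only: diff of_real)
    qed
    from this[of "sqrt e" for e] have "\<phi> (v ^ 2) \<le> 0 + e" if "0 < e" for e using that by simp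
    then have "\<phi> (v ^ 2) \<le> 0" by (rule field_le_epsilon)
    moreover have "0 \<le> \<phi> (v ^ 2)" by (intro \<phi> quadratic_module_square[OF M(1)])
    ultimately show ?thesis by simp
  qed
  have sq: "\<phi> (v ^ 2) = (\<phi> v) ^ 2" for v
  proof -
    have "(v - of_real (\<phi> v)) ^ 2 = v ^ 2 - (2 * \<phi> v) *\<^sub>R v + of_real ((\<phi> v) ^ 2)"
      by (simp add: scaleR_conv_of_real power2_eq_square algebra_simps)
    moreover have "\<phi> ((v - of_real (\<phi> v)) ^ 2) = 0" by (rule sq0) (simp add: diff of_real)
    ultimately show ?thesis by (simp only: \<phi>(1,2) diff of_real power2_eq_square)
  qed
  have mult: "\<phi> (v * w) = \<phi> v * \<phi> w" for v w
  proof -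
    have "(v + w) ^ 2 = v ^ 2 + 2 *\<^sub>R (v * w) + w ^ 2"
      by (simp add: scaleR_conv_of_real power2_eq_square algebra_simps)
    then have "\<phi> ((v + w) ^ 2) = \<phi> (v ^ 2) + 2 * \<phi> (v * w) + \<phi> (w ^ 2)" by (simp only: \<phi>)
    then show ?thesis by (simp only: sq \<phi>(1)) (simp add: power2_eq_square algebra_simps)
  qed
  show thesis by (rule that[of \<phi>]) (auto simp: real_character_def \<phi> mult)
qed

text \<open>Characters first give the weaker identity \<open>s * f = 1 + m\<close> with
  \<open>s\<close> a sum of squares and \<open>m \<in> M\<close>. The factor \<open>s\<close> is
  then removed: some \<open>f + r\<close> is in \<open>M\<close> by the archimedean property, and
  \<open>r\<close> can be lowered in steps of fixed size until it is no longer positive.\<close>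

theorem archimedean_positivstellensatz:
  fixes M :: "'a::{comm_ring_1,real_algebra_1} set"
  assumes M: "quadratic_module M" and arch: "archimedean_module M"
    and pos: "\<And>\<phi>. real_character \<phi> \<Longrightarrow> (\<And>p. p \<in> M \<Longrightarrow> 0 \<le> \<phi> p) \<Longrightarrow> 0 < \<phi> f"
  shows "f \<in> M"
proof -
  let ?N = "{m + (- f) * s | m s. m \<in> M \<and> s \<in> sum_squares}"
  have N: "quadratic_module ?N" by (rule quadratic_module_adjoin[OF M])
  have sub: "M \<subseteq> ?N" using zero_in_sum_squares by force
  \<comment> \<open>Otherwise \<open>?N\<close> extends to a maximal proper module, whose character
    is nonnegative on \<open>M\<close> and on \<open>- f\<close>, against
    \<open>pos\<close>.\<close>
  have "- 1 \<in> ?N"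
  proof (rule ccontr)
    assume "- 1 \<notin> ?N"
    then obtain D where D: "stable_submonoid (range (\<lambda>q p. q ^ 2 * p)) D" "?N \<subseteq> D" "- 1 \<notin> D"
      and max: "\<And>D'. stable_submonoid (range (\<lambda>q p. q ^ 2 * p)) D' \<Longrightarrow> D \<subseteq> D' \<Longrightarrow> - 1 \<notin> D' \<Longrightarrow> D' = D"
      using maximal_stable_submonoid[of "range (\<lambda>q p. q ^ 2 * p)" ?N "- 1"] N
      unfolding quadratic_module_def by blast
    have qD: "quadratic_module D" using D(1) subsetD[OF D(2) quadratic_moduleD(1)[OF N]] by (simp add: quadratic_module_def)
    have "archimedean_module D" using arch sub D(2) unfolding archimedean_module_def by blast
    moreover have "a \<in> D \<or> - a \<in> D" for a
      by (rule maximal_quadratic_module_total[OF qD D(3)]) (simp_all add: quadratic_module_def max)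
    ultimately obtain \<phi> where \<phi>: "real_character \<phi>" "\<And>p. p \<in> D \<Longrightarrow> 0 \<le> \<phi> p"
      using character_of_maximal_module[OF qD D(3)] by blast
    have "- f \<in> ?N" using quadratic_moduleD(2)[OF M] square_in_sum_squares[of 1] by force
    then have "0 \<le> \<phi> ((- 1) *\<^sub>R f)" using \<phi>(2) D(2) by auto
    moreover have "\<phi> ((- 1) *\<^sub>R f) = - 1 * \<phi> f" using \<phi>(1) unfolding real_character_def by blast
    ultimately have "\<phi> f \<le> 0" by simp
    moreover have "0 < \<phi> f" using pos[OF \<phi>(1)] \<phi>(2) sub D(2) by blast
    ultimately show False by simp
  qed
  then obtain m s where ms: "m \<in> M" "s \<in> sum_squares" "- 1 = m + (- f) * s" by blast
  have sf: "s * f - 1 = m" using ms(3) by (simp add: algebra_simps)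
  obtain k where k: "1 \<le> k" "of_real (2 * k) - s \<in> M" "of_real (2 * k) - 1 - s ^ 2 * f \<in> M"
  proof -
    from arch obtain r1 r2 where r: "of_real r1 - s \<in> M" "of_real r2 - (1 + s ^ 2 * f) \<in> M"
      unfolding archimedean_module_def by meson
    \<comment> \<open>\<open>2 * k\<close> has to dominate both archimedean bounds, and
      \<open>k \<ge> 1\<close> permits division by \<open>k ^ 2\<close>.\<close>
    define k where "k = max 1 (max (r1 / 2) (r2 / 2))"
    have "of_real (2 * k - r1) + (of_real r1 - s) \<in> M" "of_real (2 * k - r2) + (of_real r2 - (1 + s ^ 2 * f)) \<in> M"
      by (intro quadratic_moduleD[OF M] r quadratic_module_of_real[OF M]; simp add: k_def max_def)+
    then show thesis by (intro that[of k]) (auto simp: k_def algebra_simps)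
  qed
  \<comment> \<open>
    \<open>k\<^sup>2(f + r) - 1 = (k - s)\<^sup>2(f + r) + 2k(sf - 1) + rs(2k - s) + (2k - 1 - s\<^sup>2f)\<close>, where every
    summand on the right lies in the module; the decrement \<open>1/k\<^sup>2\<close> does not depend on \<open>r\<close>.
  \<close>
  have step: "f + of_real (r - 1 / k ^ 2) \<in> M" if r: "0 \<le> r" "f + of_real r \<in> M" for r
  proof -
    let ?R = "(of_real k - s) ^ 2 * (f + of_real r) + (2 * k) *\<^sub>R (s * f - 1) +
        r *\<^sub>R (s * (of_real (2 * k) - s)) + (of_real (2 * k) - 1 - s ^ 2 * f)"
    have "(of_real k - s) ^ 2 * (f + of_real r) \<in> M" by (rule quadratic_moduleD(4)[OF M r(2)])
    moreover have "(2 * k) *\<^sub>R (s * f - 1) \<in> M"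
      using ms(1) k(1) by (intro quadratic_module_scaleR[OF M]) (auto simp: sf)
    moreover have "r *\<^sub>R (s * (of_real (2 * k) - s)) \<in> M"
      by (intro quadratic_module_scaleR[OF M] quadratic_module_sos_mult[OF M] ms(2) k(2) r(1))
    ultimately have "?R \<in> M" using k(3) by (intro quadratic_moduleD(3)[OF M])
    then have "(1 / k ^ 2) *\<^sub>R ?R \<in> M" by (intro quadratic_module_scaleR[OF M]) auto
    moreover have "?R = (k ^ 2) *\<^sub>R (f + of_real r) - 1"
      by (simp add: scaleR_conv_of_real power2_eq_square algebra_simps)
    ultimately have "(1 / k ^ 2) *\<^sub>R ((k ^ 2) *\<^sub>R (f + of_real r) - 1) \<in> M" by (simp only:)
    then show ?thesis
      using k(1) by (simp add: scaleR_diff_right of_real_def algebra_simps)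
  qed
  \<comment> \<open>The second alternative covers constants that have become negative, where
    \<open>step\<close> is not applicable; adding back a nonnegative constant then gives
    \<open>f \<in> M\<close> directly.\<close>
  have down: "f + of_real (r - real j / k ^ 2) \<in> M \<or> f \<in> M" if r: "f + of_real r \<in> M" for r j
  proof (induction j)
    case (Suc j)
    show ?case
    proof (cases "f \<in> M \<or> 0 \<le> r - real j / k ^ 2")
      case True
      then show ?thesis using Suc step[of "r - real j / k ^ 2"] by (auto simp: add_divide_distrib algebra_simps)
    next
      case False
      then have "of_real (- (r - real j / k ^ 2)) \<in> M" by (intro quadratic_module_of_real[OF M]) simp
      moreover have "f + of_real (r - real j / k ^ 2) \<in> M" using Suc False by simp
      ultimately have "of_real (- (r - real j / k ^ 2)) + (f + of_real (r - real j / k ^ 2)) \<in> M"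
        by (rule quadratic_moduleD(3)[OF M])
      then show ?thesis by (simp add: algebra_simps)
    qed
  qed (simp add: r)
  from arch obtain r where "of_real r - (- f) \<in> M" unfolding archimedean_module_def by blast
  then have r: "f + of_real r \<in> M" by (simp add: add.commute)
  obtain j where "r * k ^ 2 \<le> real j" using real_arch_simple by blast
  then have j: "r - real j / k ^ 2 \<le> 0" using k(1) by (simp add: field_simps)
  from down[OF r, of j] show ?thesis
  proof
    assume "f + of_real (r - real j / k ^ 2) \<in> M"
    moreover have "of_real (- (r - real j / k ^ 2)) \<in> M"
      using j by (intro quadratic_module_of_real[OF M]) simp
    ultimately have "(f + of_real (r - real j / k ^ 2)) + of_real (- (r - real j / k ^ 2)) \<in> M"
      by (rule quadratic_moduleD(3)[OF M])
    then show ?thesis by (simp add: algebra_simps)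
  qed
qed


section \<open>Finite-dimensional cones\<close>

text \<open>The points \<open>x\<close> index vectors \<open>\<phi> x\<close> of which only the
  coordinates in \<open>I\<close> count. Keeping \<open>I\<close> as a parameter allows induction on
  the dimension by deleting a coordinate.\<close>

definition conic_combination :: "'i set \<Rightarrow> ('x \<Rightarrow> 'i \<Rightarrow> real) \<Rightarrow> 'x set \<Rightarrow> ('i \<Rightarrow> real) \<Rightarrow> bool"
  where "conic_combination I \<phi> X y \<longleftrightarrow>
    (\<exists>S c. finite S \<and> S \<subseteq> X \<and> (\<forall>x\<in>S. 0 \<le> c x) \<and> (\<forall>i\<in>I. y i = (\<Sum>x\<in>S. c x * \<phi> x i)))"

lemma conic_combination_zero: "conic_combination I \<phi> X (\<lambda>_. 0)"
  unfolding conic_combination_def by (auto intro!: exI[of _ "{}"])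

lemma conic_combination_point: "x \<in> X \<Longrightarrow> conic_combination I \<phi> X (\<phi> x)"
  unfolding conic_combination_def by (auto intro!: exI[of _ "{x}"] exI[of _ "\<lambda>_. 1"])

lemma conic_combination_cong:
  "conic_combination I \<phi> X y \<Longrightarrow> (\<And>i. i \<in> I \<Longrightarrow> y i = z i) \<Longrightarrow> conic_combination I \<phi> X z"
  unfolding conic_combination_def by simp

lemma conic_combination_scale:
  assumes "conic_combination I \<phi> X y" "0 \<le> d"
  shows "conic_combination I \<phi> X (\<lambda>i. d * y i)"
proof -
  from assms(1) obtain S c where "finite S" "S \<subseteq> X" "\<forall>x\<in>S. 0 \<le> c x" "\<forall>i\<in>I. y i = (\<Sum>x\<in>S. c x * \<phi> x i)"
    unfolding conic_combination_def by blast
  with assms(2) show ?thesis unfolding conic_combination_def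
    by (intro exI[of _ S] exI[of _ "\<lambda>x. d * c x"]) (auto simp: sum_distrib_left mult.assoc)
qed

lemma conic_combination_add:
  assumes "conic_combination I \<phi> X y" "conic_combination I \<phi> X z"
  shows "conic_combination I \<phi> X (\<lambda>i. y i + z i)"
proof -
  from assms(1) obtain S c where S: "finite S" "S \<subseteq> X" "\<forall>x\<in>S. 0 \<le> c x" "\<forall>i\<in>I. y i = (\<Sum>x\<in>S. c x * \<phi> x i)"
    unfolding conic_combination_def by blast
  from assms(2) obtain T d where T: "finite T" "T \<subseteq> X" "\<forall>x\<in>T. 0 \<le> d x" "\<forall>i\<in>I. z i = (\<Sum>x\<in>T. d x * \<phi> x i)"
    unfolding conic_combination_def by blast
  let ?c = "\<lambda>x. if x \<in> S then c x else 0" and ?d = "\<lambda>x. if x \<in> T then d x else 0"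
  have "(\<Sum>x\<in>S \<union> T. (?c x + ?d x) * \<phi> x i) = y i + z i" if "i \<in> I" for i
  proof -
    have "(\<Sum>x\<in>S \<union> T. ?c x * \<phi> x i) = (\<Sum>x\<in>S. c x * \<phi> x i)"
      using S(1) T(1) by (intro sum.mono_neutral_cong_right) auto
    moreover have "(\<Sum>x\<in>S \<union> T. ?d x * \<phi> x i) = (\<Sum>x\<in>T. d x * \<phi> x i)"
      using S(1) T(1) by (intro sum.mono_neutral_cong_right) auto
    ultimately show ?thesis using S(4) T(4) that by (simp add: distrib_right sum.distrib)
  qed
  then show ?thesis unfolding conic_combination_def using S T
    by (intro exI[of _ "S \<union> T"] exI[of _ "\<lambda>x. ?c x + ?d x"]) auto
qed

lemma conic_combination_mono:
  assumes "conic_combination I \<phi> X y" "X \<subseteq> Y"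
  shows "conic_combination I \<phi> Y y"
proof -
  from assms(1) obtain S c where "finite S" "S \<subseteq> X" "\<forall>x\<in>S. 0 \<le> c x" "\<forall>i\<in>I. y i = (\<Sum>x\<in>S. c x * \<phi> x i)"
    unfolding conic_combination_def by blast
  with assms(2) show ?thesis unfolding conic_combination_def
    by (intro exI[of _ S] exI[of _ c] conjI) simp_all
qed

lemma finsupp_expand:
  fixes p :: "'i \<Rightarrow>\<^sub>0 real"
  assumes "finite S" "Poly_Mapping.keys p \<subseteq> S"
  shows "p = (\<Sum>i\<in>S. Poly_Mapping.lookup p i *\<^sub>R Poly_Mapping.single i 1)"
proof (rule poly_mapping_eqI)
  fix j
  have "Poly_Mapping.lookup (\<Sum>i\<in>S. Poly_Mapping.lookup p i *\<^sub>R Poly_Mapping.single i 1) j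
      = (\<Sum>i\<in>S. if i = j then Poly_Mapping.lookup p i else 0)"
    by (intro trans[OF lookup_sum] sum.cong) (auto simp: lookup_scaleR lookup_single when_def)
  also have "\<dots> = Poly_Mapping.lookup p j"
    using assms by (auto simp: sum.delta in_keys_iff)
  finally show "Poly_Mapping.lookup p j =
    Poly_Mapping.lookup (\<Sum>i\<in>S. Poly_Mapping.lookup p i *\<^sub>R Poly_Mapping.single i 1) j" by simp
qed

text \<open>The cone is not assumed closed, so the inequality at \<open>y\<close> cannot be strict;
  nontriviality of \<open>l\<close> is what makes the result useful. A maximal cone avoiding
  \<open>y\<close> is total, and its functional is the separator.\<close>

lemma weak_separation:
  fixes \<phi> :: "'x \<Rightarrow> 'i \<Rightarrow> real"
  assumes I: "finite I" and y: "\<not> conic_combination I \<phi> X y"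
  obtains l where "\<exists>i\<in>I. l i \<noteq> 0" "\<And>x. x \<in> X \<Longrightarrow> 0 \<le> (\<Sum>i\<in>I. l i * \<phi> x i)" "(\<Sum>i\<in>I. l i * y i) \<le> 0"
proof -
  let ?T = "(\<lambda>c v. c *\<^sub>R v) ` {0 :: real..} :: (('i \<Rightarrow>\<^sub>0 real) \<Rightarrow> _) set"
  \<comment> \<open>Vectors of the finite-dimensional space are coded as finitely supported families
    with support in \<open>I\<close>; \<open>vec\<close> cuts off the other coordinates.\<close>
  define E where "E = {p :: 'i \<Rightarrow>\<^sub>0 real. Poly_Mapping.keys p \<subseteq> I}"
  define vec where "vec z = (\<Sum>i\<in>I. z i *\<^sub>R Poly_Mapping.single i (1 :: real))" for z
  have lookup_vec: "Poly_Mapping.lookup (vec z) i = (if i \<in> I then z i else 0)" for z i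
  proof -
    have "Poly_Mapping.lookup (vec z) i = (\<Sum>j\<in>I. if j = i then z j else 0)"
      unfolding vec_def by (intro trans[OF lookup_sum] sum.cong) (auto simp: lookup_scaleR lookup_single when_def)
    then show ?thesis using I by simp
  qed
  have vecE: "vec z \<in> E" for z by (auto simp: E_def in_keys_iff lookup_vec split: if_splits)
  have E: "subspace E"
    unfolding subspace_def
  proof (intro conjI ballI allI)
    fix p q assume "p \<in> E" "q \<in> E"
    then show "p + q \<in> E" unfolding E_def using Poly_Mapping.keys_add[of p q] by blast
  next
    fix c p assume "p \<in> E"
    then show "c *\<^sub>R p \<in> E" by (auto simp: E_def in_keys_iff lookup_scaleR)
  qed (simp add: E_def)
  define C where "C = {p. conic_combination I \<phi> X (Poly_Mapping.lookup p)}"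
  have "stable_submonoid ?T C"
  proof -
    have "0 \<in> C" unfolding C_def by (simp add: conic_combination_cong[OF conic_combination_zero])
    moreover have "p + q \<in> C" if "p \<in> C" "q \<in> C" for p q
    proof -
      have "Poly_Mapping.lookup (p + q) = (\<lambda>i. Poly_Mapping.lookup p i + Poly_Mapping.lookup q i)"
        by (simp add: fun_eq_iff lookup_add)
      then show ?thesis
        using conic_combination_add[of I \<phi> X "Poly_Mapping.lookup p" "Poly_Mapping.lookup q"] that by (simp add: C_def)
    qed
    moreover have "c *\<^sub>R p \<in> C" if "0 \<le> c" "p \<in> C" for c p
    proof -
      have "Poly_Mapping.lookup (c *\<^sub>R p) = (\<lambda>i. c * Poly_Mapping.lookup p i)"
        by (simp add: fun_eq_iff lookup_scaleR)
      then show ?thesis using conic_combination_scale[of I \<phi> X "Poly_Mapping.lookup p" c] that by (simp add: C_def)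
    qed
    ultimately show ?thesis unfolding stable_submonoid_def by blast
  qed
  moreover have yC: "vec y \<notin> C"
    using y conic_combination_cong[of I \<phi> X "Poly_Mapping.lookup (vec y)" y] by (auto simp: C_def lookup_vec)
  ultimately obtain D where D: "stable_submonoid ?T D" "C \<subseteq> D" "vec y \<notin> D"
    and max: "\<And>D'. stable_submonoid ?T D' \<Longrightarrow> D \<subseteq> D' \<Longrightarrow> vec y \<notin> D' \<Longrightarrow> D' = D"
    using maximal_stable_submonoid[of ?T C "vec y"] by blast
  have add: "v + w \<in> D" if "v \<in> D" "w \<in> D" for v w
    using stable_submonoidD(2)[OF D(1)] that by blast
  have scale: "c *\<^sub>R v \<in> D" if "0 \<le> c" "v \<in> D" for c v
    using stable_submonoidD(3)[OF D(1), of "\<lambda>v. c *\<^sub>R v"] that by auto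
  have D0: "0 \<in> D" by (rule stable_submonoidD(1)[OF D(1)])
  \<comment> \<open>By maximality, adjoining the ray through \<open>v\<close> captures
    \<open>y\<close>. The coefficient of \<open>v\<close> is positive because \<open>y\<close> is
    outside \<open>D\<close>.\<close>
  have "\<exists>d s. d \<in> D \<and> 0 < s \<and> vec y = d + s *\<^sub>R v" if v: "v \<notin> D" for v
  proof -
    let ?D = "{d + s *\<^sub>R v | d s. d \<in> D \<and> 0 \<le> s}"
    have sub: "D \<subseteq> ?D" by (force intro: exI[of _ "0 :: real"])
    have "stable_submonoid ?T ?D" unfolding stable_submonoid_def
    proof (intro conjI ballI)
      show "0 \<in> ?D" using sub D0 by blast
    next
      fix p q assume "p \<in> ?D" "q \<in> ?D"
      then obtain d s d' s' where "p = d + s *\<^sub>R v" "q = d' + s' *\<^sub>R v" "d \<in> D" "d' \<in> D" "0 \<le> s" "0 \<le> s'" by blast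
      then have "p + q = (d + d') + (s + s') *\<^sub>R v" "d + d' \<in> D" "0 \<le> s + s'"
        by (auto simp: algebra_simps add)
      then show "p + q \<in> ?D" by blast
    next
      fix t p assume "t \<in> ?T" "p \<in> ?D"
      then obtain c d s where "t p = c *\<^sub>R (d + s *\<^sub>R v)" "0 \<le> c" "d \<in> D" "0 \<le> s" by auto
      then have "t p = c *\<^sub>R d + (c * s) *\<^sub>R v" "c *\<^sub>R d \<in> D" "0 \<le> c * s" by (auto simp: scale scaleR_add_right)
      then show "t p \<in> ?D" by blast
    qed
    moreover have "v \<in> ?D" using D0 by (force intro: exI[of _ "1 :: real"])
    ultimately have "vec y \<in> ?D" using max sub v by blast
    then obtain d s where ds: "vec y = d + s *\<^sub>R v" "d \<in> D" "0 \<le> s" by blast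
    then have "s \<noteq> 0" using D(3) by auto
    with ds show ?thesis by (intro exI[of _ d] exI[of _ s]) auto
  qed
  note ray = this
  have total: "v \<in> D \<or> - v \<in> D" for v
  proof (rule ccontr)
    assume "\<not> (v \<in> D \<or> - v \<in> D)"
    then obtain d s e t where *: "d \<in> D" "0 < s" "vec y = d + s *\<^sub>R v" "e \<in> D" "0 < t" "vec y = e + t *\<^sub>R (- v)"
      using ray[of v] ray[of "- v"] by blast
    \<comment> \<open>The weights \<open>t\<close> and \<open>s\<close> eliminate \<open>v\<close>
      from the two representations, leaving a positive multiple of \<open>y\<close> in
      \<open>D\<close>.\<close>
    have "(t + s) *\<^sub>R vec y = t *\<^sub>R vec y + s *\<^sub>R vec y" by (rule scaleR_add_left)
    also have "\<dots> = t *\<^sub>R (d + s *\<^sub>R v) + s *\<^sub>R (e + t *\<^sub>R (- v))" using *(3,6) by (simp only:)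
    also have "\<dots> = t *\<^sub>R d + s *\<^sub>R e" by (simp add: algebra_simps)
    finally have "(t + s) *\<^sub>R vec y = t *\<^sub>R d + s *\<^sub>R e" .
    moreover have "t *\<^sub>R d + s *\<^sub>R e \<in> D" using * by (intro add scale) auto
    ultimately have "(t + s) *\<^sub>R vec y \<in> D" by simp
    from scale[OF _ this, of "1 / (t + s)"] show False using *(2,5) D(3) by simp
  qed
  \<comment> \<open>Signs that put each signed unit vector into \<open>D\<close>. Their sum over
    \<open>I\<close> is an order unit for \<open>E\<close>: the l1-norm of \<open>v\<close> is a
    large enough multiple, since it bounds every coordinate.\<close>
  define b where "b i = (if Poly_Mapping.single i 1 \<in> D then 1 else - 1 :: real)" for i
  have bD: "b i *\<^sub>R Poly_Mapping.single i (1 :: real) \<in> D" for i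
    using total[of "Poly_Mapping.single i 1"] by (auto simp: b_def)
  define u where "u = vec b"
  have unit: "\<exists>c. 0 \<le> c \<and> c *\<^sub>R u - v \<in> D" if "v \<in> E" for v
  proof -
    define c where "c = (\<Sum>i\<in>I. \<bar>Poly_Mapping.lookup v i\<bar>)"
    have "v = (\<Sum>i\<in>I. Poly_Mapping.lookup v i *\<^sub>R Poly_Mapping.single i 1)"
      using that by (intro finsupp_expand I) (simp add: E_def)
    then have "c *\<^sub>R u - v = (\<Sum>i\<in>I. c *\<^sub>R b i *\<^sub>R Poly_Mapping.single i 1) -
        (\<Sum>i\<in>I. Poly_Mapping.lookup v i *\<^sub>R Poly_Mapping.single i 1)"
      by (simp only: u_def vec_def scaleR_sum_right)
    also have "\<dots> = (\<Sum>i\<in>I. (c - Poly_Mapping.lookup v i * b i) *\<^sub>R b i *\<^sub>R Poly_Mapping.single i 1)"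
      unfolding sum_subtractf[symmetric]
      by (intro sum.cong) (auto simp: b_def scaleR_diff_left)
    also have "\<dots> \<in> D"
    proof (rule stable_submonoid_sum[OF D(1)])
      fix i assume "i \<in> I"
      then have "\<bar>Poly_Mapping.lookup v i\<bar> \<le> c" unfolding c_def using I by (intro member_le_sum) auto
      then have "0 \<le> c - Poly_Mapping.lookup v i * b i" by (auto simp: b_def)
      then show "(c - Poly_Mapping.lookup v i * b i) *\<^sub>R b i *\<^sub>R Poly_Mapping.single i 1 \<in> D"
        by (rule scale[OF _ bD])
    qed
    finally have "c *\<^sub>R u - v \<in> D" .
    moreover have "0 \<le> c" by (auto simp: c_def intro: sum_nonneg)
    ultimately show ?thesis by blast
  qed
  \<comment> \<open>Some \<open>c *\<^sub>R u + vec y\<close> with \<open>c \<ge> 0\<close> lies in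
    \<open>D\<close>; if \<open>- u\<close> did too, \<open>y\<close> would follow.\<close>
  have nu: "- u \<notin> D"
  proof
    assume u: "- u \<in> D"
    have "- vec y \<in> E" using vecE E by (intro subspace_neg)
    from unit[OF this] obtain c where "0 \<le> c" "c *\<^sub>R u - (- vec y) \<in> D" by blast
    then have "c *\<^sub>R u - (- vec y) + c *\<^sub>R (- u) \<in> D" using u by (intro add scale)
    then show False using D(3) by simp
  qed
  \<comment> \<open>The cone \<open>D\<close> is total on the whole space, but \<open>u\<close>
    dominates only elements of \<open>E\<close>, so the functional is constructed on
    \<open>E\<close>.\<close>
  obtain L :: "('i \<Rightarrow>\<^sub>0 real) \<Rightarrow> real" where L: "\<And>v w. v \<in> E \<Longrightarrow> w \<in> E \<Longrightarrow> L (v + w) = L v + L w"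
    "\<And>c v. v \<in> E \<Longrightarrow> L (c *\<^sub>R v) = c * L v" "\<And>v. v \<in> E \<Longrightarrow> v \<in> D \<Longrightarrow> 0 \<le> L v" "L u = 1"
  proof (rule total_cone_functional[of E u D])
    show "\<exists>c. c *\<^sub>R u - v \<in> D" if "v \<in> E" for v using unit[OF that] by blast
  qed (use E nu add scale total vecE in \<open>auto simp: u_def\<close>)
  define l where "l i = L (Poly_Mapping.single i 1)" for i
  have L_vec: "L (vec z) = (\<Sum>i\<in>I. l i * z i)" for z
  proof -
    have sE: "Poly_Mapping.single i 1 \<in> E" if "i \<in> I" for i using that by (simp add: E_def)
    have L0: "L 0 = 0" using L(2)[of 0 0] E by (simp add: subspace_0)
    have "J \<subseteq> I \<Longrightarrow> L (\<Sum>i\<in>J. z i *\<^sub>R Poly_Mapping.single i 1) = (\<Sum>i\<in>J. l i * z i)" if "finite J" for J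
      using that
    proof (induction J rule: finite_induct)
      case (insert i J)
      have "(\<Sum>i\<in>J. z i *\<^sub>R Poly_Mapping.single i 1) \<in> E"
        using insert.prems sE by (intro subspace_sum[OF E] subspace_scale[OF E]) auto
      moreover have "z i *\<^sub>R Poly_Mapping.single i 1 \<in> E"
        using insert.prems sE by (intro subspace_scale[OF E]) auto
      ultimately show ?case
        using insert L(2)[OF sE[of i]] by (simp add: L(1) l_def mult.commute)
    qed (simp add: L0)
    from this[OF I] show ?thesis by (simp add: vec_def)
  qed
  show thesis
  proof (rule that[of l])
    show "\<exists>i\<in>I. l i \<noteq> 0"
    proof (rule ccontr)
      assume "\<not> (\<exists>i\<in>I. l i \<noteq> 0)"
      then have "L u = 0" unfolding u_def L_vec by (intro sum.neutral) auto
      with L(4) show False by simp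
    qed
  next
    fix x assume x: "x \<in> X"
    have "vec (\<phi> x) \<in> C"
      unfolding C_def mem_Collect_eq
      by (rule conic_combination_cong[OF conic_combination_point[OF x]]) (simp add: lookup_vec)
    then have "0 \<le> L (vec (\<phi> x))" using D(2) by (intro L vecE) auto
    then show "0 \<le> (\<Sum>i\<in>I. l i * \<phi> x i)" by (simp add: L_vec)
  next
    have "0 \<le> L (- vec y)" using total[of "vec y"] D(3) by (intro L subspace_neg[OF E] vecE) auto
    also have "L (- vec y) = - L (vec y)" using L(2)[OF vecE, of "- 1" y] by simp
    finally show "(\<Sum>i\<in>I. l i * y i) \<le> 0" by (simp add: L_vec)
  qed
qed

lemma solve_coordinate:
  fixes l :: "'i \<Rightarrow> real"
  assumes "finite I" "i \<in> I" "l i \<noteq> 0" "(\<Sum>j\<in>I. l j * z j) = 0"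
  shows "z i = - (\<Sum>j\<in>I - {i}. l j * z j) / l i"
  using assms by (simp add: sum.remove[of I i] field_simps)

text \<open>The target and all points of \<open>X\<close> lie in the hyperplane
  \<open>l = 0\<close>, where coordinate \<open>i\<close> is a linear function of the others.
  Agreement on the remaining coordinates therefore extends to \<open>i\<close>.\<close>

lemma conic_combination_drop_coordinate:
  fixes l :: "'i \<Rightarrow> real"
  assumes I: "finite I" "i \<in> I" and l: "l i \<noteq> 0" "(\<Sum>j\<in>I. l j * y j) = 0"
    and X: "\<And>x. x \<in> X \<Longrightarrow> (\<Sum>j\<in>I. l j * \<phi> x j) = 0"
    and y: "conic_combination (I - {i}) \<phi> X y"
  shows "conic_combination I \<phi> X y"
proof -
  from y obtain S c where S: "finite S" "S \<subseteq> X" "\<forall>x\<in>S. 0 \<le> c x"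
    "\<forall>j\<in>I - {i}. y j = (\<Sum>x\<in>S. c x * \<phi> x j)" unfolding conic_combination_def by blast
  have "(\<Sum>j\<in>I. l j * (y j - (\<Sum>x\<in>S. c x * \<phi> x j))) = (\<Sum>j\<in>I. l j * y j) - (\<Sum>x\<in>S. c x * (\<Sum>j\<in>I. l j * \<phi> x j))"
  proof -
    have "(\<Sum>x\<in>S. c x * (\<Sum>j\<in>I. l j * \<phi> x j)) = (\<Sum>j\<in>I. l j * (\<Sum>x\<in>S. c x * \<phi> x j))"
      unfolding sum_distrib_left by (subst sum.swap) (simp add: mult.left_commute)
    then show ?thesis by (simp add: right_diff_distrib sum_subtractf)
  qed
  also have "\<dots> = 0" using l X S(2) by (simp add: subset_iff)
  finally have "y i - (\<Sum>x\<in>S. c x * \<phi> x i) = 0"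
    using solve_coordinate[where l = l and z = "\<lambda>j. y j - (\<Sum>x\<in>S. c x * \<phi> x j)", OF I l(1)] S(4) by simp
  with S(4) have "\<forall>j\<in>I. y j = (\<Sum>x\<in>S. c x * \<phi> x j)" by fastforce
  with S(1-3) show ?thesis unfolding conic_combination_def by blast
qed

text \<open>
  The theorem of Richter and Tchakaloff. If the separating functional is nonpositive on the
  integral, it vanishes almost everywhere, so that one coordinate is determined by the others.
\<close>

theorem integral_conic_combination:
  fixes \<phi> :: "'x \<Rightarrow> 'i \<Rightarrow> real"
  assumes "finite I" "AE x in \<mu>. x \<in> X"
    and "\<And>i. i \<in> I \<Longrightarrow> integrable \<mu> (\<lambda>x. \<phi> x i)"
  shows "conic_combination I \<phi> X (\<lambda>i. \<integral>x. \<phi> x i \<partial>\<mu>)"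
  using assms
proof (induction "card I" arbitrary: I X)
  case 0
  then show ?case by (auto simp: conic_combination_def intro!: exI[of _ "{}"])
next
  case (Suc n)
  let ?y = "\<lambda>i. \<integral>x. \<phi> x i \<partial>\<mu>"
  show ?case
  proof (rule ccontr)
    assume y: "\<not> conic_combination I \<phi> X ?y"
    obtain l where l: "\<exists>i\<in>I. l i \<noteq> 0" "\<And>x. x \<in> X \<Longrightarrow> 0 \<le> (\<Sum>i\<in>I. l i * \<phi> x i)"
      "(\<Sum>i\<in>I. l i * ?y i) \<le> 0"
      using weak_separation[OF Suc.prems(1) y] by blast
    then obtain i where i: "i \<in> I" "l i \<noteq> 0" by blast
    let ?f = "\<lambda>x. \<Sum>i\<in>I. l i * \<phi> x i"
    have int: "integrable \<mu> ?f" using Suc.prems(3) by auto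
    have eq: "integral\<^sup>L \<mu> ?f = (\<Sum>i\<in>I. l i * ?y i)"
      using Suc.prems(3) by (simp add: Bochner_Integration.integral_sum)
    have nn: "AE x in \<mu>. 0 \<le> ?f x" using Suc.prems(2) l(2) by (auto elim: eventually_mono)
    have "0 \<le> integral\<^sup>L \<mu> ?f" by (rule integral_nonneg_AE[OF nn])
    with eq l(3) have zero: "(\<Sum>i\<in>I. l i * ?y i) = 0" "integral\<^sup>L \<mu> ?f = 0" by auto
    then have "AE x in \<mu>. ?f x = 0" using integral_nonneg_eq_0_iff_AE[OF int nn] by simp
    with Suc.prems(2) have AE: "AE x in \<mu>. x \<in> {x \<in> X. ?f x = 0}" by eventually_elim auto
    have "conic_combination (I - {i}) \<phi> {x \<in> X. ?f x = 0} ?y"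
      using Suc.hyps(2) Suc.prems i AE by (intro Suc.hyps(1)) auto
    then have "conic_combination I \<phi> {x \<in> X. ?f x = 0} ?y"
      using Suc.prems i zero by (intro conic_combination_drop_coordinate[of I i l]) auto
    then have "conic_combination I \<phi> X ?y" by (rule conic_combination_mono) auto
    with y show False ..
  qed
qed

text \<open>Induction on the dimension, starting from a weak separator \<open>l\<close>. If
  \<open>l\<close> is negative at \<open>y\<close>, a large multiple of it is added to
  \<open>l0\<close>. Otherwise everything is restricted to the face of \<open>X\<close> where
  \<open>l\<close> vanishes; a strict separator for the face, plus a large multiple of
  \<open>l\<close>, is positive on all of \<open>X\<close> by compactness.\<close>

theorem strict_separation_compact:
  fixes \<phi> :: "'x::topological_space \<Rightarrow> 'i \<Rightarrow> real"
  assumes "finite I" "compact X" "\<not> conic_combination I \<phi> X y"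
    and "\<And>i. i \<in> I \<Longrightarrow> continuous_on X (\<lambda>x. \<phi> x i)"
    and "\<And>x. x \<in> X \<Longrightarrow> 0 < (\<Sum>i\<in>I. l0 i * \<phi> x i)"
  shows "\<exists>l. (\<forall>x\<in>X. 0 < (\<Sum>i\<in>I. l i * \<phi> x i)) \<and> (\<Sum>i\<in>I. l i * y i) < 0"
  using assms
proof (induction "card I" arbitrary: I X l0)
  case 0
  \<comment> \<open>Without coordinates the empty combination represents \<open>y\<close>, so the
    hypothesis fails.\<close>
  then show ?case by (auto simp: conic_combination_def intro: exI[of _ "{}"])
next
  case (Suc n)
  obtain l where l: "\<exists>i\<in>I. l i \<noteq> 0" "\<And>x. x \<in> X \<Longrightarrow> 0 \<le> (\<Sum>i\<in>I. l i * \<phi> x i)"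
    "(\<Sum>i\<in>I. l i * y i) \<le> 0"
    using weak_separation[OF Suc.prems(1,3)] by blast
  let ?f = "\<lambda>l x. \<Sum>i\<in>I. l i * \<phi> x i"
  have lin: "(\<Sum>i\<in>I. (c * l i + d * l' i) * z i) = c * (\<Sum>i\<in>I. l i * z i) + d * (\<Sum>i\<in>I. l' i * z i)"
    for c d :: real and l l' z
    by (simp add: distrib_right sum.distrib sum_distrib_left mult.assoc)
  have cont: "continuous_on X (?f l)" for l
    using Suc.prems(4) by (intro continuous_on_sum continuous_intros) auto
  show ?case
  proof (cases "(\<Sum>i\<in>I. l i * y i) < 0")
    case True
    let ?z = "\<Sum>i\<in>I. l0 i * y i" and ?y = "\<Sum>i\<in>I. l i * y i"
    obtain N where N: "?z < real N * (- ?y)" using True reals_Archimedean3[of "- ?y"] by auto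
    show ?thesis
    proof (rule exI[of _ "\<lambda>i. real N * l i + 1 * l0 i"], intro conjI ballI)
      fix x assume "x \<in> X"
      then show "0 < (\<Sum>i\<in>I. (real N * l i + 1 * l0 i) * \<phi> x i)"
        unfolding lin using l(2) Suc.prems(5) by (intro add_nonneg_pos) auto
    next
      show "(\<Sum>i\<in>I. (real N * l i + 1 * l0 i) * y i) < 0"
        unfolding lin using N by simp
    qed
  next
    case False
    with l(3) have zero: "(\<Sum>i\<in>I. l i * y i) = 0" by simp
    from l(1) obtain i where i: "i \<in> I" "l i \<noteq> 0" by blast
    let ?X = "{x \<in> X. ?f l x = 0}"
    have compX: "compact ?X"
    proof -
      have "closedin (top_of_set X) (X \<inter> ?f l -` {0})"
        by (rule continuous_closedin_preimage[OF cont]) simp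
      moreover have "X \<inter> ?f l -` {0} = ?X" by auto
      ultimately show ?thesis using Suc.prems(2) closedin_compact by metis
    qed
    \<comment> \<open>Where \<open>l\<close> vanishes, a multiple of \<open>l\<close> may be
      subtracted to kill coefficient \<open>i\<close>. In this way \<open>l0\<close> supplies the
      positive functional that the induction hypothesis asks for.\<close>
    have drop: "(\<Sum>j\<in>I. l' j * z j) = (\<Sum>j\<in>I - {i}. (1 * l' j + (- (l' i / l i)) * l j) * z j)"
      if "(\<Sum>j\<in>I. l j * z j) = 0" for l' z
    proof -
      have "(\<Sum>j\<in>I. l' j * z j) = (\<Sum>j\<in>I. (1 * l' j + (- (l' i / l i)) * l j) * z j)"
        unfolding lin using that by simp
      also have "\<dots> = (\<Sum>j\<in>I - {i}. (1 * l' j + (- (l' i / l i)) * l j) * z j)"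
        using i Suc.prems(1) by (simp add: sum.remove[of I i])
      finally show ?thesis .
    qed
    have ncc: "\<not> conic_combination (I - {i}) \<phi> ?X y"
    proof
      assume "conic_combination (I - {i}) \<phi> ?X y"
      then have "conic_combination I \<phi> ?X y"
        using Suc.prems i zero by (intro conic_combination_drop_coordinate[of I i l]) auto
      then have "conic_combination I \<phi> X y" by (rule conic_combination_mono) auto
      with Suc.prems(3) show False ..
    qed
    have "\<exists>l'. (\<forall>x\<in>?X. 0 < (\<Sum>j\<in>I - {i}. l' j * \<phi> x j)) \<and> (\<Sum>j\<in>I - {i}. l' j * y j) < 0"
    proof (rule Suc.hyps(1)[OF _ _ compX ncc])
      show "0 < (\<Sum>j\<in>I - {i}. (1 * l0 j + (- (l0 i / l i)) * l j) * \<phi> x j)" if "x \<in> ?X" for x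
        using that Suc.prems(5)[of x] drop[of "\<phi> x" l0] by auto
    qed (use Suc.hyps(2) Suc.prems(1,4) i in \<open>auto intro: continuous_on_subset\<close>)
    then obtain l' where l': "\<forall>x\<in>?X. 0 < (\<Sum>j\<in>I - {i}. l' j * \<phi> x j)" "(\<Sum>j\<in>I - {i}. l' j * y j) < 0"
      by blast
    define m where "m = l'(i := 0)"
    have m: "(\<Sum>j\<in>I. m j * z j) = (\<Sum>j\<in>I - {i}. l' j * z j)" for z
      using i Suc.prems(1) by (simp add: sum.remove[of I i] m_def)
    \<comment> \<open>Only here can \<open>m\<close> fail to be positive. On this compact set
      \<open>l\<close> has a positive minimum, because a zero of \<open>l\<close> would lie in
      \<open>?X\<close>, where \<open>m\<close> is positive.\<close>
    let ?Y = "{x \<in> X. ?f m x \<le> 0}"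
    have compY: "compact ?Y"
    proof -
      have "closedin (top_of_set X) (X \<inter> ?f m -` {..0})"
        by (rule continuous_closedin_preimage[OF cont]) simp
      moreover have "X \<inter> ?f m -` {..0} = ?Y" by auto
      ultimately show ?thesis using Suc.prems(2) closedin_compact by metis
    qed
    obtain N where N: "0 \<le> N" "\<And>x. x \<in> ?Y \<Longrightarrow> 0 < N * ?f l x + ?f m x"
    proof (cases "?Y = {}")
      case True
      then show thesis using that[of 0] by auto
    next
      case False
      have attains: "\<exists>p\<in>?Y. \<forall>x\<in>?Y. ?f l p \<le> ?f l x" for l
        by (rule continuous_attains_inf[OF compY False continuous_on_subset[OF cont]]) auto
      obtain p where p: "p \<in> ?Y" "\<And>x. x \<in> ?Y \<Longrightarrow> ?f l p \<le> ?f l x" using attains[of l] by blast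
      obtain q where q: "q \<in> ?Y" "\<And>x. x \<in> ?Y \<Longrightarrow> ?f m q \<le> ?f m x" using attains[of m] by blast
      have "?f l p \<noteq> 0"
      proof
        assume "?f l p = 0"
        with p(1) l'(1) have "0 < (\<Sum>j\<in>I - {i}. l' j * \<phi> p j)" by blast
        with p(1) m[of "\<phi> p"] show False by simp
      qed
      moreover have "0 \<le> ?f l p" using p(1) l(2) by blast
      ultimately have pos: "0 < ?f l p" by linarith
      \<comment> \<open>Chosen so that \<open>N\<close> times the minimum of \<open>l\<close> plus
        the minimum of \<open>m\<close> equals 1.\<close>
      define N where "N = (1 - ?f m q) / ?f l p"
      have "?f m q \<le> 0" using q(1) by simp
      then have "0 \<le> N" using pos by (simp add: N_def)
      moreover have "0 < N * ?f l x + ?f m x" if "x \<in> ?Y" for x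
      proof -
        have "1 - ?f m q = N * ?f l p" using pos by (simp add: N_def)
        also have "\<dots> \<le> N * ?f l x" using \<open>0 \<le> N\<close> p(2)[OF that] by (intro mult_left_mono)
        finally show ?thesis using q(2)[OF that] by linarith
      qed
      ultimately show thesis by (rule that)
    qed
    show ?thesis
    proof (rule exI[of _ "\<lambda>i. N * l i + 1 * m i"], intro conjI ballI)
      fix x assume x: "x \<in> X"
      show "0 < (\<Sum>i\<in>I. (N * l i + 1 * m i) * \<phi> x i)"
      proof (cases "x \<in> ?Y")
        case True
        then show ?thesis unfolding lin using N(2) by simp
      next
        case False
        then have "0 < ?f m x" using x by auto
        moreover have "0 \<le> N * ?f l x" using N(1) l(2)[OF x] by simp
        ultimately show ?thesis unfolding lin by simp
      qed
    next
      show "(\<Sum>i\<in>I. (N * l i + 1 * m i) * y i) < 0"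
        unfolding lin using zero l'(2) m[of y] by simp
    qed
  qed
qed


section \<open>The polynomial algebra\<close>

lemma scaleR_single:
  "c *\<^sub>R Poly_Mapping.single k v = Poly_Mapping.single k (c *\<^sub>R v :: 'b::real_vector)"
proof (rule poly_mapping_eqI)
  fix j
  have "finite {i. c *\<^sub>R Poly_Mapping.lookup (Poly_Mapping.single k v) i \<noteq> 0}"
    by (rule finite_subset[of _ "{k}"]) (auto simp: lookup_single when_def split: if_splits)
  then show "Poly_Mapping.lookup (c *\<^sub>R Poly_Mapping.single k v) j = Poly_Mapping.lookup (Poly_Mapping.single k (c *\<^sub>R v)) j"
    by (simp add: scaleR_poly_mapping_def Abs_poly_mapping_inverse lookup_single when_def)
qed

lemma single_add_induct [case_names zero add]:
  assumes "P 0" "\<And>k v f. P f \<Longrightarrow> P (Poly_Mapping.single k v + f)"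
  shows "P (f :: 'a \<Rightarrow>\<^sub>0 'b::monoid_add)"
proof (induction f rule: update_induct)
  case (update f k v)
  have "Poly_Mapping.update k v f = Poly_Mapping.single k v + f"
    using update(1) by (intro poly_mapping_eqI) (auto simp: lookup_update lookup_add lookup_single when_def in_keys_iff)
  with update show ?case by (simp add: assms(2))
qed (rule assms(1))

text \<open>This makes the results on commutative real algebras applicable to polynomials.
  Compatibility of scaling with products is reduced to single terms in each factor.\<close>

instance poly_mapping :: (monoid_add, real_algebra) real_algebra
proof
  fix c :: real and p q :: "'a \<Rightarrow>\<^sub>0 'b"
  have single: "c *\<^sub>R Poly_Mapping.single k v * q = c *\<^sub>R (Poly_Mapping.single k v * q) \<and>
      Poly_Mapping.single k v * c *\<^sub>R q = c *\<^sub>R (Poly_Mapping.single k v * q)" for k and v :: 'b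
    by (induction q rule: single_add_induct)
      (simp_all add: distrib_left scaleR_add_right mult_single scaleR_single)
  show "c *\<^sub>R p * q = c *\<^sub>R (p * q)" "p * c *\<^sub>R q = c *\<^sub>R (p * q)"
    by (induction p rule: single_add_induct) (simp_all add: single distrib_right scaleR_add_right)
qed

instance poly_mapping :: (monoid_add, real_algebra_1) real_algebra_1 ..

lemma of_real_eq_pconst: "of_real c = pconst c"
  by (simp add: of_real_def pconst_def scaleR_single flip: single_one)

lemma poly_expand_monomials:
  "p = (\<Sum>\<alpha>\<in>Poly_Mapping.keys p. Poly_Mapping.lookup p \<alpha> *\<^sub>R pmonom \<alpha>)"
  unfolding pmonom_def by (rule finsupp_expand) auto

lemma pmonom_zero: "pmonom 0 = 1"
  by (simp add: pmonom_def)

lemma pmonom_add: "pmonom (\<alpha> + \<beta>) = pmonom \<alpha> * pmonom \<beta>"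
  by (simp add: pmonom_def mult_single)

lemma pmonom_sum: "finite S \<Longrightarrow> pmonom (\<Sum>i\<in>S. f i) = (\<Prod>i\<in>S. pmonom (f i))"
  by (induction S rule: finite_induct) (auto simp: pmonom_zero pmonom_add)

lemma pmonom_axis:
  fixes i :: "'n::finite"
  shows "pmonom (axis i n) = pvar i ^ n"
proof (induction n)
  case 0
  have "axis i 0 = (0 :: 'n expo)" by (simp add: vec_eq_iff axis_def)
  then show ?case by (simp only: pmonom_zero power_0)
next
  case (Suc n)
  have "axis i (Suc n) = axis i 1 + axis i n" by (simp add: vec_eq_iff axis_def)
  then have "pmonom (axis i (Suc n)) = pvar i * pmonom (axis i n)"
    by (simp add: pvar_def pmonom_add)
  with Suc show ?case by simp
qed

lemma pmonom_eq_prod: "pmonom \<alpha> = (\<Prod>i\<in>UNIV. pvar i ^ (\<alpha> $ i))"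
proof -
  have "\<alpha> = (\<Sum>i\<in>UNIV. axis i (\<alpha> $ i))"
    by (simp add: vec_eq_iff axis_def)
  then have "pmonom \<alpha> = pmonom (\<Sum>i\<in>UNIV. axis i (\<alpha> $ i))" by simp
  then show ?thesis by (simp add: pmonom_sum pmonom_axis)
qed

section \<open>Evaluation as a pairing, and evaluation at points as the only characters\<close>

lemma peval_eq_pairing: "peval p x = pairing p (\<lambda>\<alpha>. mono_eval \<alpha> x)"
  by (simp add: peval_def pairing_def)

lemma peval_add: "peval (p + q) x = peval p x + peval q x"
  by (simp add: peval_eq_pairing pairing_add)

lemma peval_sum: "peval (\<Sum>i\<in>I. f i) x = (\<Sum>i\<in>I. peval (f i) x)"
  by (simp add: peval_eq_pairing pairing_sum)

lemma peval_scaleR: "peval (c *\<^sub>R p) x = c * peval p x"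
  by (simp add: peval_eq_pairing pairing_scaleR)

lemma peval_diff: "peval (p - q) x = peval p x - peval q x"
  using peval_add[of p "(- 1) *\<^sub>R q" x] peval_scaleR[of "- 1" q x] by simp

lemma pairing_single: "pairing (Poly_Mapping.single \<alpha> c) w = c * w \<alpha>"
  by (subst pairing_superset[of "{\<alpha>}"]) (auto simp: lookup_single)

lemma mono_eval_add: "mono_eval (\<alpha> + \<beta>) x = mono_eval \<alpha> x * mono_eval \<beta> x"
  by (simp add: mono_eval_def power_add prod.distrib)

lemma peval_pmonom: "peval (pmonom \<alpha>) x = mono_eval \<alpha> x"
  by (simp add: peval_eq_pairing pmonom_def pairing_single)

lemma peval_pconst: "peval (pconst c) x = c"
  by (simp add: peval_eq_pairing pconst_def pairing_single mono_eval_def)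

lemma peval_one: "peval 1 x = 1"
  using peval_pconst[of 1 x] by (simp add: pconst_def)

lemma peval_pvar: "peval (pvar i) x = x $ i"
proof -
  have "mono_eval (axis i 1) x = (\<Prod>j\<in>UNIV. if j = i then x $ j else 1)"
    unfolding mono_eval_def by (intro prod.cong) (auto simp: axis_def)
  then show ?thesis by (simp add: pvar_def peval_pmonom)
qed

lemma peval_mult: "peval (p * q) x = peval p x * peval q x"
proof -
  have "peval (p * q) x = (\<Sum>\<alpha>\<in>Poly_Mapping.keys p. \<Sum>\<beta>\<in>Poly_Mapping.keys q.
      (Poly_Mapping.lookup p \<alpha> * Poly_Mapping.lookup q \<beta>) * (mono_eval \<alpha> x * mono_eval \<beta> x))"
    by (subst mult_expand[of "Poly_Mapping.keys p" p "Poly_Mapping.keys q" q])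
      (simp_all add: peval_eq_pairing pairing_sum pairing_single mono_eval_add)
  also have "\<dots> = peval p x * peval q x"
    unfolding peval_def sum_product by (intro sum.cong) auto
  finally show ?thesis .
qed

lemma peval_power2: "peval (p ^ 2) x = (peval p x) ^ 2"
  by (simp add: power2_eq_square peval_mult)

lemma continuous_on_peval: "continuous_on S (peval p)"
  unfolding peval_def mono_eval_def by (intro continuous_intros)

text \<open>The variables generate the algebra, so a character is determined by its values on them,
  which are the coordinates of the point.\<close>

lemma real_character_eq_peval:
  fixes \<phi> :: "'n::finite rpoly \<Rightarrow> real"
  assumes "real_character \<phi>"
  shows "\<phi> p = peval p (\<chi> i. \<phi> (pvar i))"
proof -
  have \<phi>: "\<phi> 1 = 1" "\<phi> (p + q) = \<phi> p + \<phi> q" "\<phi> (p * q) = \<phi> p * \<phi> q" "\<phi> (c *\<^sub>R p) = c * \<phi> p" for p q c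
    using assms by (auto simp: real_character_def)
  have zero: "\<phi> 0 = 0" using \<phi>(4)[of 0 0] by simp
  have sum: "\<phi> (\<Sum>i\<in>I. f i) = (\<Sum>i\<in>I. \<phi> (f i))" for I :: "'n expo set" and f
    by (induction I rule: infinite_finite_induct) (auto simp: \<phi> zero)
  have power: "\<phi> (p ^ n) = \<phi> p ^ n" for p n by (induction n) (auto simp: \<phi>)
  have prod: "\<phi> (\<Prod>i\<in>I. f i) = (\<Prod>i\<in>I. \<phi> (f i))" for I :: "'n set" and f
    by (induction I rule: infinite_finite_induct) (auto simp: \<phi>)
  have "\<phi> p = (\<Sum>\<alpha>\<in>Poly_Mapping.keys p. Poly_Mapping.lookup p \<alpha> * \<phi> (pmonom \<alpha>))"
    by (subst poly_expand_monomials) (simp only: sum \<phi>(4))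
  then show ?thesis by (simp add: peval_def mono_eval_def pmonom_eq_prod prod power)
qed

lemma keys_polys_in:
  assumes "p \<in> polys_in A"
  shows "Poly_Mapping.keys p \<subseteq> A"
  using assms unfolding polys_in_def
proof (induction rule: span_induct)
  case base
  show ?case unfolding subspace_def
  proof (intro conjI ballI allI CollectI)
    fix p q :: "'a rpoly" assume "p \<in> {p. Poly_Mapping.keys p \<subseteq> A}" "q \<in> {p. Poly_Mapping.keys p \<subseteq> A}"
    then show "Poly_Mapping.keys (p + q) \<subseteq> A" using Poly_Mapping.keys_add[of p q] by blast
  next
    fix c and p :: "'a rpoly" assume "p \<in> {p. Poly_Mapping.keys p \<subseteq> A}"
    then show "Poly_Mapping.keys (c *\<^sub>R p) \<subseteq> A" by (auto simp: in_keys_iff lookup_scaleR)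
  qed simp
next
  case (step p)
  then show ?case by (auto simp: pmonom_def)
qed

lemma pairing_cong:
  "(\<And>\<alpha>. \<alpha> \<in> Poly_Mapping.keys p \<Longrightarrow> y \<alpha> = z \<alpha>) \<Longrightarrow> pairing p y = pairing p z"
  by (simp add: pairing_def)

lemma pairing_point_masses:
  assumes "\<And>\<alpha>. \<alpha> \<in> Poly_Mapping.keys p \<Longrightarrow> w \<alpha> = (\<Sum>x\<in>S. c x * mono_eval \<alpha> x)"
  shows "pairing p w = (\<Sum>x\<in>S. c x * peval p x)"
proof -
  have "pairing p w = (\<Sum>\<alpha>\<in>Poly_Mapping.keys p. \<Sum>x\<in>S. c x * (Poly_Mapping.lookup p \<alpha> * mono_eval \<alpha> x))"
    by (simp add: pairing_def assms sum_distrib_left mult.left_commute)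
  then show ?thesis by (subst (asm) sum.swap) (simp add: peval_def sum_distrib_left)
qed


section \<open>Truncations\<close>

lemma sos_eq_sum_squares: "sos = sum_squares"
  by (simp add: sos_def sum_squares_def)

lemma polys_upto_mono: "d \<le> e \<Longrightarrow> polys_upto d \<subseteq> polys_upto e"
  by (auto simp: polys_upto_def)

lemma polys_uptoI: "int (tdeg p) \<le> d \<Longrightarrow> p \<in> polys_upto d"
  using mdeg_le_tdeg[of _ p] by (fastforce simp: polys_upto_def)

lemma ideal_trunc_mono:
  assumes "k \<le> l"
  shows "ideal_trunc k h \<subseteq> ideal_trunc l h"
proof -
  have "polys_upto (int k - d) \<subseteq> polys_upto (int l - d)" for d
    using assms by (intro polys_upto_mono) simp
  then show ?thesis unfolding ideal_trunc_def by blast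
qed

lemma qmodule_trunc_mono:
  assumes "k \<le> l"
  shows "qmodule_trunc k g \<subseteq> qmodule_trunc l g"
proof -
  have "sos_upto (int (2 * k) - d) \<subseteq> sos_upto (int (2 * l) - d)" for d
    using assms polys_upto_mono[of "int (2 * k) - d" "int (2 * l) - d"] by (auto simp: sos_upto_def)
  from this this[of 0] show ?thesis unfolding qmodule_trunc_def by (simp only: diff_0_right) blast
qed

text \<open>In the union over all orders the degree bounds disappear: an order as large as the sum
  of all degrees involved admits any given multipliers.\<close>

lemma mem_ideal_of_iff: "f \<in> ideal_of h \<longleftrightarrow> (\<exists>p. f = (\<Sum>i<length h. h ! i * p i))"
proof
  assume "\<exists>p. f = (\<Sum>i<length h. h ! i * p i)"
  then obtain p where p: "f = (\<Sum>i<length h. h ! i * p i)" ..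
  define k where "k = (\<Sum>i<length h. tdeg (h ! i) + tdeg (p i))"
  have "p i \<in> polys_upto (int (2 * k) - int (tdeg (h ! i)))" if "i < length h" for i
  proof -
    have "tdeg (h ! i) + tdeg (p i) \<le> k" unfolding k_def using that by (intro member_le_sum) auto
    then show ?thesis by (intro polys_uptoI) linarith
  qed
  with p show "f \<in> ideal_of h" unfolding ideal_of_def ideal_trunc_def by blast
qed (auto simp: ideal_of_def ideal_trunc_def)

lemma mem_qmodule_iff:
  "f \<in> qmodule g \<longleftrightarrow>
    (\<exists>\<sigma>\<^sub>0 \<sigma>. f = \<sigma>\<^sub>0 + (\<Sum>j<length g. g ! j * \<sigma> j) \<and> \<sigma>\<^sub>0 \<in> sum_squares \<and> (\<forall>j<length g. \<sigma> j \<in> sum_squares))"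
proof
  assume "\<exists>\<sigma>\<^sub>0 \<sigma>. f = \<sigma>\<^sub>0 + (\<Sum>j<length g. g ! j * \<sigma> j) \<and> \<sigma>\<^sub>0 \<in> sum_squares \<and> (\<forall>j<length g. \<sigma> j \<in> sum_squares)"
  then obtain \<sigma>\<^sub>0 \<sigma> where \<sigma>: "f = \<sigma>\<^sub>0 + (\<Sum>j<length g. g ! j * \<sigma> j)" "\<sigma>\<^sub>0 \<in> sum_squares"
    "\<forall>j<length g. \<sigma> j \<in> sum_squares" by blast
  define k where "k = tdeg \<sigma>\<^sub>0 + (\<Sum>j<length g. tdeg (g ! j) + tdeg (\<sigma> j))"
  have "tdeg \<sigma>\<^sub>0 \<le> 2 * k" by (simp add: k_def)
  then have "\<sigma>\<^sub>0 \<in> polys_upto (int (2 * k))" by (intro polys_uptoI) simp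
  then have "\<sigma>\<^sub>0 \<in> sos_upto (int (2 * k))" using \<sigma>(2) by (simp add: sos_upto_def sos_eq_sum_squares)
  moreover have "\<sigma> j \<in> sos_upto (int (2 * k) - int (tdeg (g ! j)))" if "j < length g" for j
  proof -
    have "tdeg (g ! j) + tdeg (\<sigma> j) \<le> (\<Sum>j<length g. tdeg (g ! j) + tdeg (\<sigma> j))"
      using that by (intro member_le_sum) auto
    then have "tdeg (g ! j) + tdeg (\<sigma> j) \<le> k" by (simp add: k_def)
    then have "\<sigma> j \<in> polys_upto (int (2 * k) - int (tdeg (g ! j)))" by (intro polys_uptoI) linarith
    with \<sigma>(3) that show ?thesis by (simp add: sos_upto_def sos_eq_sum_squares)
  qed
  ultimately show "f \<in> qmodule g" using \<sigma>(1) unfolding qmodule_def qmodule_trunc_def by blast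
qed (auto simp: qmodule_def qmodule_trunc_def sos_upto_def sos_eq_sum_squares)

lemma ideal_plus_qmodule_trunc:
  assumes "f \<in> ideal_of h + qmodule g"
  obtains k where "f \<in> qmodule_trunc k g + ideal_trunc (2 * k) h"
proof -
  from assms obtain p q k l where "f = p + q" "p \<in> ideal_trunc (2 * k) h" "q \<in> qmodule_trunc l g"
    by (auto simp: set_plus_def ideal_of_def qmodule_def)
  then have "f = q + p" "q \<in> qmodule_trunc (max k l) g" "p \<in> ideal_trunc (2 * max k l) h"
    using qmodule_trunc_mono[of l "max k l" g] ideal_trunc_mono[of "2 * k" "2 * max k l" h] by auto
  then show thesis by (intro that[of "max k l"]) (auto simp: set_plus_def)
qed

section \<open>Algebraic closure properties of the full ideal and quadratic module\<close>

lemma ideal_of_add: "p \<in> ideal_of h \<Longrightarrow> q \<in> ideal_of h \<Longrightarrow> p + q \<in> ideal_of h"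
  unfolding mem_ideal_of_iff
proof clarify
  fix p q :: "nat \<Rightarrow> 'a rpoly"
  show "\<exists>r. (\<Sum>i<length h. h ! i * p i) + (\<Sum>i<length h. h ! i * q i) = (\<Sum>i<length h. h ! i * r i)"
    by (rule exI[of _ "\<lambda>i. p i + q i"]) (simp add: distrib_left sum.distrib)
qed

lemma ideal_of_mult: "p \<in> ideal_of h \<Longrightarrow> q * p \<in> ideal_of h"
  unfolding mem_ideal_of_iff
proof clarify
  fix p :: "nat \<Rightarrow> 'a rpoly"
  show "\<exists>r. q * (\<Sum>i<length h. h ! i * p i) = (\<Sum>i<length h. h ! i * r i)"
    by (rule exI[of _ "\<lambda>i. q * p i"]) (simp add: sum_distrib_left mult.left_commute)
qed

lemma ideal_of_zero: "0 \<in> ideal_of h"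
  unfolding mem_ideal_of_iff by (rule exI[of _ "\<lambda>_. 0"]) simp

lemma generator_in_ideal:
  assumes "q \<in> set h"
  shows "q \<in> ideal_of h"
proof -
  from assms obtain i where i: "i < length h" "q = h ! i" by (auto simp: in_set_conv_nth)
  have "(\<Sum>j<length h. h ! j * (if j = i then 1 else 0)) = (\<Sum>j<length h. if j = i then h ! j else 0)"
    by (intro sum.cong) auto
  with i show ?thesis unfolding mem_ideal_of_iff by (intro exI[of _ "\<lambda>j. if j = i then 1 else 0"]) simp
qed

lemma quadratic_module_qmodule: "quadratic_module (qmodule g)"
proof (rule quadratic_moduleI)
  show "1 \<in> qmodule g"
    unfolding mem_qmodule_iff using square_in_sum_squares[of "1 :: 'a rpoly"]
    by (intro exI[of _ 1] exI[of _ "\<lambda>_. 0"]) (simp add: zero_in_sum_squares)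
next
  fix p q assume "p \<in> qmodule g" "q \<in> qmodule g"
  then obtain \<sigma>\<^sub>0 \<sigma> \<tau>\<^sub>0 \<tau> where
    "p = \<sigma>\<^sub>0 + (\<Sum>j<length g. g ! j * \<sigma> j)" "\<sigma>\<^sub>0 \<in> sum_squares" "\<forall>j<length g. \<sigma> j \<in> sum_squares"
    "q = \<tau>\<^sub>0 + (\<Sum>j<length g. g ! j * \<tau> j)" "\<tau>\<^sub>0 \<in> sum_squares" "\<forall>j<length g. \<tau> j \<in> sum_squares"
    unfolding mem_qmodule_iff by blast
  then show "p + q \<in> qmodule g" unfolding mem_qmodule_iff
    by (intro exI[of _ "\<sigma>\<^sub>0 + \<tau>\<^sub>0"] exI[of _ "\<lambda>j. \<sigma> j + \<tau> j"])
      (auto simp: distrib_left sum.distrib intro: add_in_sum_squares)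
next
  fix p q assume "p \<in> qmodule g"
  then obtain \<sigma>\<^sub>0 \<sigma> where
    "p = \<sigma>\<^sub>0 + (\<Sum>j<length g. g ! j * \<sigma> j)" "\<sigma>\<^sub>0 \<in> sum_squares" "\<forall>j<length g. \<sigma> j \<in> sum_squares"
    unfolding mem_qmodule_iff by blast
  then show "q ^ 2 * p \<in> qmodule g" unfolding mem_qmodule_iff
    by (intro exI[of _ "q ^ 2 * \<sigma>\<^sub>0"] exI[of _ "\<lambda>j. q ^ 2 * \<sigma> j"])
      (auto simp: distrib_left sum_distrib_left mult.left_commute intro: square_mult_in_sum_squares)
qed

lemma generator_in_qmodule:
  assumes "q \<in> set g"
  shows "q \<in> qmodule g"
proof -
  from assms obtain i where i: "i < length g" "q = g ! i" by (auto simp: in_set_conv_nth)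
  have "(\<Sum>j<length g. g ! j * (if j = i then 1 else 0)) = (\<Sum>j<length g. if j = i then g ! j else 0)"
    by (intro sum.cong) auto
  with i show ?thesis unfolding mem_qmodule_iff using square_in_sum_squares[of "1 :: 'a rpoly"]
    by (intro exI[of _ 0] exI[of _ "\<lambda>j. if j = i then 1 else 0"]) (simp add: zero_in_sum_squares)
qed

lemma quadratic_module_ideal_plus_qmodule: "quadratic_module (ideal_of h + qmodule g)"
proof (rule quadratic_moduleI)
  show "1 \<in> ideal_of h + qmodule g"
    using set_plus_intro[OF ideal_of_zero quadratic_moduleD(1)[OF quadratic_module_qmodule], of h g] by simp
next
  fix p q assume "p \<in> ideal_of h + qmodule g" "q \<in> ideal_of h + qmodule g"
  then obtain p1 p2 q1 q2 where "p = p1 + p2" "q = q1 + q2" "p1 \<in> ideal_of h" "q1 \<in> ideal_of h"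
    "p2 \<in> qmodule g" "q2 \<in> qmodule g" by (auto simp: set_plus_def)
  then have "p + q = (p1 + q1) + (p2 + q2)" "p1 + q1 \<in> ideal_of h" "p2 + q2 \<in> qmodule g"
    using ideal_of_add quadratic_moduleD(3)[OF quadratic_module_qmodule] by (auto simp: algebra_simps)
  then show "p + q \<in> ideal_of h + qmodule g" by (metis set_plus_intro)
next
  fix p q assume "p \<in> ideal_of h + qmodule g"
  then obtain p1 p2 where "p = p1 + p2" "p1 \<in> ideal_of h" "p2 \<in> qmodule g" by (auto simp: set_plus_def)
  then have "q ^ 2 * p = q ^ 2 * p1 + q ^ 2 * p2" "q ^ 2 * p1 \<in> ideal_of h" "q ^ 2 * p2 \<in> qmodule g"
    using ideal_of_mult quadratic_moduleD(4)[OF quadratic_module_qmodule] by (auto simp: distrib_left)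
  then show "q ^ 2 * p \<in> ideal_of h + qmodule g" by (metis set_plus_intro)
qed

lemma peval_sum_squares_nonneg:
  assumes "s \<in> sum_squares"
  shows "0 \<le> peval s x"
  using assms
  by (induction s rule: sum_squares_induct) (simp_all add: peval_add peval_power2 peval_eq_pairing[of 0])

lemma peval_nonneg_on_semialg:
  assumes f: "f \<in> ideal_of h + qmodule g" and x: "x \<in> semialg h g"
  shows "0 \<le> peval f x"
proof -
  from f obtain p \<sigma>\<^sub>0 \<sigma> where "f = (\<Sum>i<length h. h ! i * p i) + (\<sigma>\<^sub>0 + (\<Sum>j<length g. g ! j * \<sigma> j))"
    and \<sigma>: "\<sigma>\<^sub>0 \<in> sum_squares" "\<forall>j<length g. \<sigma> j \<in> sum_squares"
    unfolding set_plus_def mem_Collect_eq Bex_def mem_ideal_of_iff mem_qmodule_iff by blast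
  moreover have "peval (h ! i) x = 0" if "i < length h" for i using x that by (simp add: semialg_def)
  moreover have "0 \<le> peval (g ! j) x" if "j < length g" for j using x that by (simp add: semialg_def)
  ultimately show ?thesis
    by (auto simp: peval_add peval_sum peval_mult peval_sum_squares_nonneg
        intro!: add_nonneg_nonneg sum_nonneg mult_nonneg_nonneg)
qed


section \<open>Putinar's Positivstellensatz\<close>

text \<open>These elements form a subalgebra when \<open>M\<close> is a quadratic module. The bound
  is kept at least 1 because \<open>quadratic_module_bounded_square\<close> needs a positive
  constant.\<close>

definition bounded_elements :: "'a::{comm_ring_1,real_algebra_1} set \<Rightarrow> 'a set"
  where "bounded_elements M = {p. \<exists>r\<ge>1. of_real r - p \<in> M \<and> of_real r + p \<in> M}"

lemma bounded_elementsI: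
  assumes M: "quadratic_module M" and p: "of_real r - p \<in> M" "of_real s + p \<in> M"
  shows "p \<in> bounded_elements M"
proof -
  define t where "t = max 1 (max r s)"
  have "of_real (t - r) + (of_real r - p) \<in> M" "of_real (t - s) + (of_real s + p) \<in> M"
    by (rule quadratic_moduleD(3)[OF M quadratic_module_of_real[OF M] p(1)]
        quadratic_moduleD(3)[OF M quadratic_module_of_real[OF M] p(2)]; simp add: t_def)+
  then show ?thesis by (auto simp: bounded_elements_def t_def intro!: exI[of _ "max 1 (max r s)"])
qed

lemma bounded_elements_add:
  assumes M: "quadratic_module M" and "p \<in> bounded_elements M" "q \<in> bounded_elements M"
  shows "p + q \<in> bounded_elements M"
proof -
  from assms(2,3) obtain r s where *: "of_real r - p \<in> M" "of_real r + p \<in> M" "of_real s - q \<in> M" "of_real s + q \<in> M"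
    unfolding bounded_elements_def by blast
  have "of_real (r + s) - (p + q) \<in> M" "of_real (r + s) + (p + q) \<in> M"
    using quadratic_moduleD(3)[OF M *(1,3)] quadratic_moduleD(3)[OF M *(2,4)] by (simp_all add: algebra_simps)
  then show ?thesis by (rule bounded_elementsI[OF M])
qed

lemma bounded_elements_scaleR:
  assumes M: "quadratic_module M" and "p \<in> bounded_elements M"
  shows "c *\<^sub>R p \<in> bounded_elements M"
proof -
  from assms(2) obtain r where r: "of_real r - p \<in> M" "of_real r + p \<in> M"
    unfolding bounded_elements_def by blast
  have *: "of_real (\<bar>c\<bar> * r) - \<bar>c\<bar> *\<^sub>R p \<in> M" "of_real (\<bar>c\<bar> * r) + \<bar>c\<bar> *\<^sub>R p \<in> M"
    using quadratic_module_scaleR[OF M r(1) abs_ge_zero[of c]] quadratic_module_scaleR[OF M r(2) abs_ge_zero[of c]]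
    by (simp_all add: of_real_def scaleR_diff_right scaleR_add_right)
  show ?thesis
  proof (cases "0 \<le> c")
    case True
    with * show ?thesis by (intro bounded_elementsI[OF M, of "\<bar>c\<bar> * r" _ "\<bar>c\<bar> * r"]) simp_all
  next
    case False
    with * show ?thesis by (intro bounded_elementsI[OF M, of "\<bar>c\<bar> * r" _ "\<bar>c\<bar> * r"]) simp_all
  qed
qed

lemma bounded_elements_of_real:
  assumes M: "quadratic_module M"
  shows "of_real c \<in> bounded_elements M"
  by (rule bounded_elementsI[OF M, of c _ "- c"]) (simp_all add: quadratic_moduleD(2)[OF M])

lemma bounded_elements_square:
  assumes M: "quadratic_module M" and "p \<in> bounded_elements M"
  shows "p ^ 2 \<in> bounded_elements M"
proof -
  from assms(2) obtain r where r: "1 \<le> r" "of_real r - p \<in> M" "of_real r + p \<in> M"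
    unfolding bounded_elements_def by blast
  have "of_real (r ^ 2) - p ^ 2 \<in> M" using r by (intro quadratic_module_bounded_square[OF M]) auto
  moreover have "of_real 0 + p ^ 2 \<in> M" by (simp add: quadratic_module_square[OF M])
  ultimately show ?thesis by (rule bounded_elementsI[OF M])
qed

text \<open>Products reduce to squares by polarization.\<close>

lemma bounded_elements_mult:
  assumes M: "quadratic_module M" and pq: "p \<in> bounded_elements M" "q \<in> bounded_elements M"
  shows "p * q \<in> bounded_elements M"
proof -
  have "(1/2) *\<^sub>R ((p + q) ^ 2 + (- 1) *\<^sub>R (p ^ 2 + q ^ 2)) \<in> bounded_elements M"
    by (intro bounded_elements_scaleR[OF M] bounded_elements_add[OF M] bounded_elements_square[OF M] pq)
  moreover have "(p + q) ^ 2 + (- 1) *\<^sub>R (p ^ 2 + q ^ 2) = 2 *\<^sub>R (p * q)"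
    by (simp add: scaleR_conv_of_real power2_eq_square algebra_simps)
  ultimately show ?thesis by simp
qed

text \<open>Since bounded elements form a subalgebra, it is enough to bound the variables. Adding
  the squares of the other variables to the ball condition bounds each square
  \<open>pvar i ^ 2\<close>, and completing a square then bounds \<open>pvar i\<close>.\<close>

lemma archimedean_module_ideal_plus_qmodule:
  fixes h g :: "('n::finite rpoly) list"
  assumes "archimedean h g"
  shows "archimedean_module (ideal_of h + qmodule g)"
proof -
  let ?M = "ideal_of h + qmodule g" and ?B = "bounded_elements (ideal_of h + qmodule g)"
  have M: "quadratic_module ?M" by (rule quadratic_module_ideal_plus_qmodule)
  from assms obtain R where R: "of_real R - (\<Sum>i\<in>UNIV. pvar i ^ 2) \<in> ?M"
    unfolding archimedean_def of_real_eq_pconst[symmetric] by blast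
  have var: "pvar i \<in> ?B" for i :: 'n
  proof -
    have "(\<Sum>j\<in>UNIV - {i}. pvar j ^ 2) \<in> ?M"
      using M quadratic_module_square[OF M] unfolding quadratic_module_def by (blast intro: stable_submonoid_sum)
    from quadratic_moduleD(3)[OF M R this] have *: "of_real R - pvar i ^ 2 \<in> ?M"
      by (simp add: sum.remove[of UNIV i])
    have sq: "of_real (R + c ^ 2) + (2 * c) *\<^sub>R pvar i \<in> ?M" for c
    proof -
      have "(of_real R - pvar i ^ 2) + (pvar i + of_real c) ^ 2 = of_real (R + c ^ 2) + (2 * c) *\<^sub>R pvar i"
        by (simp add: scaleR_conv_of_real power2_eq_square algebra_simps)
      with quadratic_moduleD(3)[OF M * quadratic_module_square[OF M, of "pvar i + of_real c"]] show ?thesis by simp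
    qed
    show ?thesis
      \<comment> \<open>These two values make the coefficient \<open>2 * c\<close> equal to -1 and
        1.\<close>
      using sq[of "- (1/2)"] sq[of "1/2"] by (intro bounded_elementsI[OF M, of "R + 1/4" _ "R + 1/4"]) (simp_all add: power2_eq_square)
  qed
  have one: "1 \<in> ?B" using bounded_elements_of_real[OF M, of 1] by simp
  have power: "p ^ n \<in> ?B" if "p \<in> ?B" for p n
    by (induction n) (auto intro: one bounded_elements_mult[OF M that])
  have prod: "(\<Prod>i\<in>I. f i) \<in> ?B" if "\<And>i. f i \<in> ?B" for f and I :: "'n set"
    by (induction I rule: infinite_finite_induct) (auto intro: one bounded_elements_mult[OF M that])
  have sum: "(\<Sum>i\<in>I. f i) \<in> ?B" if "\<And>i. f i \<in> ?B" for f and I :: "'n expo set"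
    using bounded_elements_of_real[OF M, of 0]
    by (induction I rule: infinite_finite_induct) (auto intro: bounded_elements_add[OF M that])
  have "p \<in> ?B" for p
    by (subst poly_expand_monomials, unfold pmonom_eq_prod) (intro sum bounded_elements_scaleR[OF M] prod power var)
  then show ?thesis unfolding archimedean_module_def bounded_elements_def by blast
qed

text \<open>A character nonnegative on the module is evaluation at some point. Each \<open>q\<close>
  in \<open>h\<close> is in the ideal together with \<open>- q\<close>, hence vanishes there, and
  each \<open>q\<close> in \<open>g\<close> is nonnegative there: the point lies in K.\<close>

theorem putinar:
  fixes h g :: "('n::finite rpoly) list"
  assumes arch: "archimedean h g" and pos: "\<And>x. x \<in> semialg h g \<Longrightarrow> 0 < peval f x"
  shows "f \<in> ideal_of h + qmodule g"
proof (rule archimedean_positivstellensatz[OF quadratic_module_ideal_plus_qmodule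
      archimedean_module_ideal_plus_qmodule[OF arch]])
  fix \<phi> :: "'n rpoly \<Rightarrow> real"
  assume \<phi>: "real_character \<phi>" and nn: "\<And>p. p \<in> ideal_of h + qmodule g \<Longrightarrow> 0 \<le> \<phi> p"
  define x where "x = (\<chi> i. \<phi> (pvar i))"
  have ev: "\<phi> p = peval p x" for p unfolding x_def by (rule real_character_eq_peval[OF \<phi>])
  have "peval q x = 0" if "q \<in> set h" for q
  proof -
    have q: "q \<in> ideal_of h" by (rule generator_in_ideal[OF that])
    have "0 \<le> \<phi> (r + 0)" if "r \<in> ideal_of h" for r
      by (rule nn[OF set_plus_intro[OF that quadratic_moduleD(2)[OF quadratic_module_qmodule]]])
    from this[OF q] this[OF ideal_of_mult[OF q, of "pconst (- 1)"]] show ?thesis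
      by (simp add: ev peval_mult peval_pconst)
  qed
  moreover have "0 \<le> peval q x" if "q \<in> set g" for q
    using nn[OF set_plus_intro[OF ideal_of_zero generator_in_qmodule[OF that]]] by (simp add: ev)
  ultimately have "x \<in> semialg h g" by (simp add: semialg_def)
  from pos[OF this] show "0 < \<phi> f" by (simp add: ev)
qed

section \<open>Closedness of K, and its compactness in the archimedean case\<close>

lemma closed_semialg: "closed (semialg h g)"
proof -
  have "semialg h g = (\<Inter>q\<in>set h. {x. peval q x = 0}) \<inter> (\<Inter>q\<in>set g. {x. 0 \<le> peval q x})"
    by (auto simp: semialg_def)
  then show ?thesis
    by (auto intro!: closed_Collect_eq closed_Collect_le continuous_on_peval continuous_on_const)
qed

lemma compact_semialg:
  fixes h g :: "('n::finite rpoly) list"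
  assumes "archimedean h g"
  shows "compact (semialg h g)"
proof -
  from assms obtain R where R: "pconst R - (\<Sum>i\<in>UNIV. pvar i ^ 2) \<in> ideal_of h + qmodule g"
    unfolding archimedean_def by blast
  have "norm x \<le> sqrt R" if "x \<in> semialg h g" for x
  proof -
    have "(\<Sum>i\<in>UNIV. (x $ i)\<^sup>2) \<le> R"
      using peval_nonneg_on_semialg[OF R that]
      by (simp add: peval_diff peval_pconst peval_sum peval_power2 peval_pvar)
    then show ?thesis by (simp add: norm_vec_def L2_set_def)
  qed
  then have "bounded (semialg h g)" by (auto simp: bounded_iff)
  with closed_semialg show ?thesis by (auto simp: compact_eq_bounded_closed)
qed


section \<open>Moment relaxations\<close>

text \<open>
  Leading terms of squares cannot cancel: if the sum of two elements of a finite set of exponents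
  has a unique representation, then by symmetry the two elements coincide, and the coefficient of
  that sum in a sum of squares is a sum of squares of coefficients.
\<close>

lemma sos_degree:
  fixes ps :: "('n::finite rpoly) list"
  assumes d: "(\<Sum>p\<leftarrow>ps. p ^ 2) \<in> polys_upto d" and p: "p \<in> set ps" and \<alpha>: "\<alpha> \<in> Poly_Mapping.keys p"
  shows "2 * int (mdeg \<alpha>) \<le> d"
proof -
  define P where "P = (\<Union>p\<in>set ps. Poly_Mapping.keys p)"
  have P: "finite P" "\<alpha> \<in> P" using p \<alpha> by (auto simp: P_def)
  then have ne: "P \<noteq> {}" by blast
  obtain \<beta> \<gamma> where \<beta>: "\<beta> \<in> P" "\<gamma> \<in> P" "\<forall>\<alpha>\<in>P. mdeg \<alpha> \<le> mdeg \<beta>" "\<forall>\<alpha>\<in>P. mdeg \<alpha> \<le> mdeg \<gamma>"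
    and uniq: "\<And>\<alpha>' \<beta>'. \<alpha>' \<in> P \<Longrightarrow> \<beta>' \<in> P \<Longrightarrow> \<alpha>' + \<beta>' = \<beta> + \<gamma> \<Longrightarrow> \<alpha>' = \<beta> \<and> \<beta>' = \<gamma>"
  proof (rule unique_top_sum[OF P(1) ne P(1) ne])
    fix \<beta> \<gamma>
    assume "\<beta> \<in> P" "\<gamma> \<in> P" "\<forall>\<alpha>\<in>P. mdeg \<alpha> \<le> mdeg \<beta>" "\<forall>\<alpha>\<in>P. mdeg \<alpha> \<le> mdeg \<gamma>"
      "\<And>\<alpha>' \<beta>'. \<alpha>' \<in> P \<Longrightarrow> \<beta>' \<in> P \<Longrightarrow> \<alpha>' + \<beta>' = \<beta> + \<gamma> \<Longrightarrow> \<alpha>' = \<beta> \<and> \<beta>' = \<gamma>"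
    then show thesis by (rule that)
  qed
  have "\<gamma> = \<beta>" by (rule conjunct1[OF uniq[OF \<beta>(2,1) add.commute]])
  note uniq = uniq[unfolded this]
  have coeff: "Poly_Mapping.lookup (q ^ 2) (\<beta> + \<beta>) = (Poly_Mapping.lookup q \<beta>) ^ 2" if q: "q \<in> set ps" for q
  proof -
    have qP: "Poly_Mapping.keys q \<subseteq> P" using q by (auto simp: P_def)
    have "Poly_Mapping.lookup (q * q) (\<beta> + \<beta>) = (\<Sum>\<alpha>'\<in>P. \<Sum>\<beta>'\<in>P.
        if \<alpha>' + \<beta>' = \<beta> + \<beta> then Poly_Mapping.lookup q \<alpha>' * Poly_Mapping.lookup q \<beta>' else 0)"
      by (subst mult_expand[OF P(1) qP P(1) qP]) (auto simp: lookup_sum lookup_single when_def)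
    also have "\<dots> = (\<Sum>\<alpha>'\<in>P. \<Sum>\<beta>'\<in>P. if \<alpha>' = \<beta> then
        (if \<beta>' = \<beta> then Poly_Mapping.lookup q \<beta> * Poly_Mapping.lookup q \<beta> else 0) else 0)"
      by (intro sum.cong refl) (auto dest: uniq)
    also have "\<dots> = (\<Sum>\<alpha>'\<in>P. if \<alpha>' = \<beta> then Poly_Mapping.lookup q \<beta> * Poly_Mapping.lookup q \<beta> else 0)"
      by (intro sum.cong refl) (use \<beta> P(1) in auto)
    also have "\<dots> = Poly_Mapping.lookup q \<beta> * Poly_Mapping.lookup q \<beta>" using \<beta> P(1) by auto
    finally show ?thesis by (simp add: power2_eq_square)
  qed
  have "Poly_Mapping.lookup (\<Sum>p\<leftarrow>qs. p ^ 2) (\<beta> + \<beta>) = (\<Sum>p\<leftarrow>qs. (Poly_Mapping.lookup p \<beta>) ^ 2)"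
    if "set qs \<subseteq> set ps" for qs
    using that by (induction qs) (auto simp: lookup_add coeff)
  moreover have "(\<Sum>p\<leftarrow>ps. (Poly_Mapping.lookup p \<beta>) ^ 2) \<noteq> 0"
  proof
    assume "(\<Sum>p\<leftarrow>ps. (Poly_Mapping.lookup p \<beta>) ^ 2) = 0"
    then have "\<forall>p\<in>set ps. (Poly_Mapping.lookup p \<beta>) ^ 2 = 0"
      by (subst (asm) sum_list_nonneg_eq_0_iff) auto
    with \<beta>(1) show False by (auto simp: P_def in_keys_iff)
  qed
  ultimately have "\<beta> + \<beta> \<in> Poly_Mapping.keys (\<Sum>p\<leftarrow>ps. p ^ 2)" by (simp add: in_keys_iff)
  then have "int (mdeg (\<beta> + \<beta>)) \<le> d" using d unfolding polys_upto_def by blast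
  moreover have "mdeg \<alpha> \<le> mdeg \<beta>" using P(2) \<beta>(3) by blast
  ultimately show ?thesis by (simp add: mdeg_add)
qed

lemma riesz_square_nonneg:
  assumes psd: "psd_on (loc_index k q) (loc_matrix k q w)"
    and p: "\<And>\<alpha>. \<alpha> \<in> Poly_Mapping.keys p \<Longrightarrow> 2 * mdeg \<alpha> + tdeg q \<le> 2 * k"
  shows "0 \<le> riesz w (q * p ^ 2)"
proof (cases "p = 0")
  case False
  \<comment> \<open>A nonzero \<open>p\<close> forces \<open>tdeg q \<le> 2 * k\<close>, so the
    natural subtraction below is not truncated.\<close>
  then obtain \<gamma> where "\<gamma> \<in> Poly_Mapping.keys p" by fastforce
  with p have q: "tdeg q \<le> 2 * k" by fastforce
  have "tdeg p \<le> (2 * k - tdeg q) div 2"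
    unfolding tdeg_le_iff[of p] using p by fastforce
  with q have "2 * tdeg p + tdeg q \<le> 2 * k" by linarith
  moreover have "tdeg (q * p ^ 2) \<le> tdeg q + (tdeg p + tdeg p)"
    unfolding power2_eq_square by (meson add_left_mono order_trans tdeg_mult_le)
  ultimately have "tdeg (q * p ^ 2) \<le> 2 * k" by linarith
  then have "riesz w (q * p ^ 2) = (\<Sum>\<alpha>\<in>loc_index k q. \<Sum>\<beta>\<in>loc_index k q.
      Poly_Mapping.lookup p \<alpha> * loc_matrix k q w \<alpha> \<beta> * Poly_Mapping.lookup p \<beta>)"
    using loc_matrix_spec[of k q w] unfolding is_loc_matrix_def by blast
  then show ?thesis using psd unfolding psd_on_def by simp
qed simp

text \<open>The degree bound is on the whole sum, while \<open>riesz_square_nonneg\<close> needs it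
  for every square; \<open>sos_degree\<close> transfers it, as leading terms do not cancel.\<close>

lemma riesz_sos_nonneg:
  assumes psd: "psd_on (loc_index k q) (loc_matrix k q w)" and s: "s \<in> sos_upto (int (2 * k) - int (tdeg q))"
  shows "0 \<le> riesz w (q * s)"
proof -
  from s obtain ps where ps: "s = (\<Sum>p\<leftarrow>ps. p ^ 2)" by (auto simp: sos_upto_def sos_def)
  have deg: "2 * mdeg \<alpha> + tdeg q \<le> 2 * k" if "p \<in> set ps" "\<alpha> \<in> Poly_Mapping.keys p" for p \<alpha>
    using sos_degree[of ps _ p \<alpha>] s that unfolding sos_upto_def ps by fastforce
  have "0 \<le> riesz w (q * (\<Sum>p\<leftarrow>qs. p ^ 2))" if "set qs \<subseteq> set ps" for qs
    using that
  proof (induction qs)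
    case (Cons p qs)
    have "0 \<le> riesz w (q * p ^ 2)" using Cons.prems deg by (intro riesz_square_nonneg[OF psd]) auto
    with Cons show ?case by (simp add: distrib_left pairing_add)
  qed simp
  then show ?thesis unfolding ps by blast
qed

lemma riesz_qmodule_nonneg:
  assumes w: "w \<in> Phi_set k g" and f: "f \<in> qmodule_trunc k g"
  shows "0 \<le> riesz w f"
proof -
  from f obtain \<sigma>\<^sub>0 \<sigma> where f: "f = \<sigma>\<^sub>0 + (\<Sum>j<length g. g ! j * \<sigma> j)" "\<sigma>\<^sub>0 \<in> sos_upto (int (2 * k))"
    "\<forall>j<length g. \<sigma> j \<in> sos_upto (int (2 * k) - int (tdeg (g ! j)))"
    unfolding qmodule_trunc_def by blast
  have psd: "psd_on (loc_index k q) (loc_matrix k q w)" if "q \<in> set (1 # g)" for q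
    using w that unfolding Phi_set_def by blast
  have "tdeg (1 :: 'a rpoly) = 0" by (simp add: tdeg_def deg_set_def mdeg_def)
  then have "0 \<le> riesz w (1 * \<sigma>\<^sub>0)" using f(2) by (intro riesz_sos_nonneg[OF psd]) auto
  moreover have "0 \<le> riesz w (g ! j * \<sigma> j)" if "j < length g" for j
    using f(3) that by (intro riesz_sos_nonneg[OF psd]) auto
  ultimately show ?thesis
    by (auto simp: f(1) pairing_add pairing_sum intro!: add_nonneg_nonneg sum_nonneg)
qed

text \<open>
  The localizing matrix of an equation of odd degree does not reach multipliers of the maximal
  degree, so a relaxation of higher order than the truncation of the ideal is used.
\<close>

lemma riesz_ideal_zero:
  assumes w: "w \<in> E_set k h" and f: "f \<in> ideal_trunc l h" and l: "l \<le> k"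
  shows "riesz w f = 0"
proof -
  from f obtain p where p: "f = (\<Sum>i<length h. h ! i * p i)"
    "\<forall>i<length h. p i \<in> polys_upto (int l - int (tdeg (h ! i)))" unfolding ideal_trunc_def by blast
  have "riesz w (h ! i * p i) = 0" if i: "i < length h" for i
  proof -
    have "riesz w (h ! i * pmonom \<gamma>) = 0" if "\<gamma> \<in> Poly_Mapping.keys (p i)" for \<gamma>
    proof -
      have "int (mdeg \<gamma>) \<le> int l - int (tdeg (h ! i))" using p(2) i that unfolding polys_upto_def by blast
      \<comment> \<open>Row \<gamma> and column 0 carry the value at
        \<open>h ! i * pmonom \<gamma>\<close>. With \<open>d\<close> the degree of
        \<open>h ! i\<close>, the index \<gamma> is admissible because
        \<open>2(l - d) + d \<le> 2l \<le> 2k\<close>.\<close>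
      then have idx: "\<gamma> \<in> loc_index k (h ! i)" "0 \<in> loc_index k (h ! i)"
        using l by (auto simp: loc_index_def mdeg_def[of 0])
      then have "loc_matrix k (h ! i) w \<gamma> 0 = 0" using w i unfolding E_set_def by auto
      with idx show ?thesis by (simp add: loc_matrix_eq)
    qed
    moreover have "h ! i * p i = (\<Sum>\<gamma>\<in>Poly_Mapping.keys (p i). Poly_Mapping.lookup (p i) \<gamma> *\<^sub>R (h ! i * pmonom \<gamma>))"
      by (subst poly_expand_monomials[of "p i"]) (simp add: sum_distrib_left)
    ultimately show ?thesis by (simp add: pairing_sum pairing_scaleR)
  qed
  then show ?thesis by (simp add: p(1) pairing_sum)
qed

text \<open>Evaluating the certificate at a feasible \<open>w\<close> gives a nonnegative number by
  membership and a negative one by the linear equations. Order \<open>2 * k\<close> is requested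
  because \<open>riesz_ideal_zero\<close> is applied to the ideal truncated at degree
  \<open>2 * k\<close>.\<close>

lemma certificate_infeasible:
  assumes A: "finite A" "set a \<subseteq> polys_in A" and cert: "certificate k lam a b h g"
    and l: "2 * k \<le> l"
  shows "\<not> feasible_rel l a b A h g"
proof
  assume "feasible_rel l a b A h g"
  then obtain w where w: "\<forall>i<length a. pairing (a ! i) (restrict w A) = b ! i" "w \<in> Phi_set l g" "w \<in> E_set l h"
    unfolding feasible_rel_def by blast
  let ?f = "\<Sum>i<length a. (lam ! i) *\<^sub>R (a ! i)"
  from cert obtain p q where pq: "?f = p + q" "p \<in> qmodule_trunc k g" "q \<in> ideal_trunc (2 * k) h"
    by (auto simp: certificate_def set_plus_def)
  have "p \<in> qmodule_trunc l g" using pq(2) qmodule_trunc_mono[of k l g] l by auto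
  then have "0 \<le> riesz w p" by (rule riesz_qmodule_nonneg[OF w(2)])
  moreover have "riesz w q = 0" by (rule riesz_ideal_zero[OF w(3) pq(3) l])
  ultimately have "0 \<le> riesz w ?f" by (simp add: pq(1) pairing_add)
  also have "riesz w ?f = (\<Sum>i<length a. b ! i * lam ! i)"
  proof -
    have "riesz w (a ! i) = b ! i" if "i < length a" for i
    proof -
      have "Poly_Mapping.keys (a ! i) \<subseteq> A" using A(2) that by (intro keys_polys_in) auto
      then have "pairing (a ! i) w = pairing (a ! i) (restrict w A)" by (intro pairing_cong) auto
      with w(1) that show ?thesis by simp
    qed
    then show ?thesis by (simp add: pairing_sum pairing_scaleR mult.commute)
  qed
  finally show False using cert by (simp add: certificate_def)
qed

section \<open>Passage between measures, atomic measures and relaxations\<close>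

lemma mdeg_le_deg_set: "finite A \<Longrightarrow> \<alpha> \<in> A \<Longrightarrow> mdeg \<alpha> \<le> deg_set A"
  unfolding deg_set_def by (intro Max_ge) auto

text \<open>The given measure may lack moments up to degree \<open>2 * k\<close>. It is replaced by
  finitely many atoms in K with the same moments on \<open>A\<close>, and these have moments of
  every degree.\<close>

lemma feasible_imp_feasible_rel:
  fixes h g :: "('n::finite rpoly) list"
  assumes A: "finite A" and feas: "feasible a b A (semialg h g)" and k: "is_order A k"
  shows "feasible_rel k a b A h g"
proof -
  let ?K = "semialg h g"
  from feas obtain y \<mu> where y: "\<forall>i<length a. pairing (a ! i) y = b ! i" "y \<in> A \<rightarrow>\<^sub>E UNIV"
    and \<mu>: "AE x in \<mu>. x \<in> ?K" "\<forall>\<alpha>\<in>A. integrable \<mu> (mono_eval \<alpha>) \<and> y \<alpha> = integral\<^sup>L \<mu> (mono_eval \<alpha>)"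
    unfolding feasible_def moment_cone_def by blast
  have "conic_combination A (\<lambda>x \<alpha>. mono_eval \<alpha> x) ?K (\<lambda>\<alpha>. integral\<^sup>L \<mu> (mono_eval \<alpha>))"
    using \<mu> by (intro integral_conic_combination[OF A]) auto
  then obtain S c where S: "finite S" "S \<subseteq> ?K" "\<forall>x\<in>S. 0 \<le> c x"
    and rep: "\<forall>\<alpha>\<in>A. integral\<^sup>L \<mu> (mono_eval \<alpha>) = (\<Sum>x\<in>S. c x * mono_eval \<alpha> x)"
    unfolding conic_combination_def by blast
  define w where "w = restrict (\<lambda>\<alpha>. \<Sum>x\<in>S. c x * mono_eval \<alpha> x) (expos_upto (2 * k))"
  have w: "w \<in> expos_upto (2 * k) \<rightarrow>\<^sub>E UNIV" by (simp add: w_def)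
  have AE: "A \<subseteq> expos_upto (2 * k)"
  proof
    fix \<alpha> assume "\<alpha> \<in> A"
    then have "mdeg \<alpha> \<le> deg_set A" by (rule mdeg_le_deg_set[OF A])
    with k show "\<alpha> \<in> expos_upto (2 * k)" by (simp add: is_order_def expos_upto_def)
  qed
  have y_eq: "y = restrict w A"
  proof
    fix \<alpha>
    show "y \<alpha> = restrict w A \<alpha>"
      using y(2) \<mu>(2) rep AE by (cases "\<alpha> \<in> A") (auto simp: w_def PiE_def extensional_def)
  qed
  \<comment> \<open>The localizing matrix is a combination of rank-one matrices, one for each atom,
    with weights \<open>c x * peval q x\<close>. These are nonnegative for \<open>q\<close> in
    \<open>1 # g\<close> and zero for \<open>q\<close> in \<open>h\<close>.\<close>
  have loc: "loc_matrix k q w \<alpha> \<beta> = (\<Sum>x\<in>S. c x * peval q x * (mono_eval \<alpha> x * mono_eval \<beta> x))"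
    if ab: "\<alpha> \<in> loc_index k q" "\<beta> \<in> loc_index k q" for q \<alpha> \<beta>
  proof -
    have "riesz w (q * pmonom (\<alpha> + \<beta>)) = (\<Sum>x\<in>S. c x * peval (q * pmonom (\<alpha> + \<beta>)) x)"
    proof (rule pairing_point_masses)
      fix \<gamma> assume \<gamma>: "\<gamma> \<in> Poly_Mapping.keys (q * pmonom (\<alpha> + \<beta>))"
      have "tdeg (pmonom (\<alpha> + \<beta>)) = mdeg \<alpha> + mdeg \<beta>"
        by (simp add: tdeg_def deg_set_def pmonom_def mdeg_add)
      then have "mdeg \<gamma> \<le> tdeg q + (mdeg \<alpha> + mdeg \<beta>)"
        using mdeg_le_tdeg[OF \<gamma>] tdeg_mult_le[of q "pmonom (\<alpha> + \<beta>)"] by simp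
      then have "\<gamma> \<in> expos_upto (2 * k)" using ab by (simp add: loc_index_def expos_upto_def)
      then show "w \<gamma> = (\<Sum>x\<in>S. c x * mono_eval \<gamma> x)" by (simp add: w_def)
    qed
    with ab show ?thesis by (simp add: loc_matrix_eq peval_mult peval_pmonom mono_eval_add mult.assoc)
  qed
  have "w \<in> Phi_set k g"
  proof -
    have "psd_on (loc_index k q) (loc_matrix k q w)" if q: "q \<in> set (1 # g)" for q
    proof -
      let ?I = "loc_index k q"
      have "0 \<le> (\<Sum>\<alpha>\<in>?I. \<Sum>\<beta>\<in>?I. v \<alpha> * loc_matrix k q w \<alpha> \<beta> * v \<beta>)" for v
      proof -
        have "(\<Sum>\<alpha>\<in>?I. \<Sum>\<beta>\<in>?I. v \<alpha> * loc_matrix k q w \<alpha> \<beta> * v \<beta>) =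
            (\<Sum>\<alpha>\<in>?I. \<Sum>\<beta>\<in>?I. \<Sum>x\<in>S. c x * peval q x * ((v \<alpha> * mono_eval \<alpha> x) * (v \<beta> * mono_eval \<beta> x)))"
          by (intro sum.cong refl) (simp add: loc sum_distrib_left sum_distrib_right mult_ac)
        also have "\<dots> = (\<Sum>\<alpha>\<in>?I. \<Sum>x\<in>S. \<Sum>\<beta>\<in>?I. c x * peval q x * ((v \<alpha> * mono_eval \<alpha> x) * (v \<beta> * mono_eval \<beta> x)))"
          by (intro sum.cong refl sum.swap)
        also have "\<dots> = (\<Sum>x\<in>S. \<Sum>\<alpha>\<in>?I. \<Sum>\<beta>\<in>?I. c x * peval q x * ((v \<alpha> * mono_eval \<alpha> x) * (v \<beta> * mono_eval \<beta> x)))"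
          by (rule sum.swap)
        also have "\<dots> = (\<Sum>x\<in>S. c x * peval q x * (\<Sum>\<alpha>\<in>?I. v \<alpha> * mono_eval \<alpha> x) ^ 2)"
          unfolding power2_eq_square sum_product by (simp only: sum_distrib_left)
        also have "\<dots> \<ge> 0"
        proof (intro sum_nonneg mult_nonneg_nonneg)
          fix x assume "x \<in> S"
          then show "0 \<le> c x" "0 \<le> peval q x" using S q by (auto simp: semialg_def peval_one)
        qed simp
        finally show ?thesis .
      qed
      moreover have "\<forall>\<alpha>\<in>?I. \<forall>\<beta>\<in>?I. loc_matrix k q w \<alpha> \<beta> = loc_matrix k q w \<beta> \<alpha>"
        by (auto simp: loc mult.commute)
      ultimately show ?thesis by (simp add: psd_on_def)
    qed
    with w show ?thesis by (simp add: Phi_set_def)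
  qed
  moreover have "w \<in> E_set k h"
  proof -
    have "loc_matrix k q w \<alpha> \<beta> = 0" if "q \<in> set h" "\<alpha> \<in> loc_index k q" "\<beta> \<in> loc_index k q" for q \<alpha> \<beta>
    proof -
      have "peval q x = 0" if "x \<in> S" for x using S(2) that \<open>q \<in> set h\<close> by (auto simp: semialg_def)
      then show ?thesis by (simp add: loc that)
    qed
    with w show ?thesis by (simp add: E_set_def)
  qed
  ultimately show ?thesis
    using y(1) y_eq unfolding feasible_rel_def by (intro exI[of _ y] exI[of _ w] conjI IntI)
qed

lemma conic_combination_feasible:
  fixes K :: "(real ^ 'n::finite) set"
  assumes a: "set a \<subseteq> polys_in A"
    and y: "conic_combination {..<length a} (\<lambda>x i. peval (a ! i) x) K (\<lambda>i. b ! i)"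
  shows "feasible a b A K"
proof -
  from y obtain S c where S: "finite S" "S \<subseteq> K" "\<forall>x\<in>S. 0 \<le> c x"
    and rep: "\<forall>i<length a. b ! i = (\<Sum>x\<in>S. c x * peval (a ! i) x)"
    unfolding conic_combination_def by auto
  \<comment> \<open>The point measure has only \<open>S\<close> as its space; the image under the
    identity is a measure on the Borel sets.\<close>
  define \<mu> where "\<mu> = distr (point_measure S (\<lambda>x. ennreal (c x))) borel (\<lambda>x. x)"
  define y where "y = restrict (\<lambda>\<alpha>. \<Sum>x\<in>S. c x * mono_eval \<alpha> x) A"
  have id: "(\<lambda>x. x) \<in> measurable (point_measure S (\<lambda>x. ennreal (c x))) borel" by simp
  have meas: "mono_eval \<alpha> \<in> borel_measurable borel" for \<alpha> :: "'n expo"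
    using continuous_on_peval[of UNIV "pmonom \<alpha>"]
    by (intro borel_measurable_continuous_onI) (simp add: peval_pmonom[abs_def])
  have "integrable \<mu> (mono_eval \<alpha>)" for \<alpha>
    unfolding \<mu>_def using S(1) by (simp add: integrable_distr_eq[OF id meas] integrable_point_measure_finite)
  moreover have "integral\<^sup>L \<mu> (mono_eval \<alpha>) = (\<Sum>x\<in>S. c x * mono_eval \<alpha> x)" for \<alpha>
    unfolding \<mu>_def using S(1,3)
    by (simp add: integral_distr[OF id meas] lebesgue_integral_point_measure_finite)
  moreover have "AE x in \<mu>. x \<in> K"
  proof -
    have "AE x in \<mu>. x \<in> S"
      unfolding \<mu>_def using finite_imp_closed[OF S(1)]
      by (subst AE_distr_iff[OF id]) (auto intro!: AE_I2 simp: space_point_measure)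
    then show ?thesis using S(2) by (auto elim: eventually_mono)
  qed
  moreover have "sets \<mu> = sets borel" by (simp add: \<mu>_def)
  ultimately have "y \<in> moment_cone A K" unfolding moment_cone_def by (auto simp: y_def)
  moreover have "pairing (a ! i) y = b ! i" if "i < length a" for i
  proof -
    have "Poly_Mapping.keys (a ! i) \<subseteq> A" using a that by (intro keys_polys_in) auto
    then have "pairing (a ! i) y = (\<Sum>x\<in>S. c x * peval (a ! i) x)"
      by (intro pairing_point_masses) (auto simp: y_def)
    with rep that show ?thesis by simp
  qed
  ultimately show ?thesis unfolding feasible_def by blast
qed

text \<open>A set forgets order and repetitions; the certificate needs coefficients indexed by list
  position.\<close>

lemma span_list:
  assumes "p \<in> span (set a)"
  obtains l where "p = (\<Sum>i<length a. l i *\<^sub>R (a ! i))"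
proof -
  have "\<exists>l. p = (\<Sum>i<length a. l i *\<^sub>R (a ! i))"
    using assms
  proof (induction rule: span_induct)
    case base
    show ?case unfolding subspace_def
    proof (intro conjI ballI allI CollectI)
      show "\<exists>l. 0 = (\<Sum>i<length a. l i *\<^sub>R a ! i)" by (rule exI[of _ "\<lambda>_. 0"]) simp
    next
      fix p q assume "p \<in> {p. \<exists>l. p = (\<Sum>i<length a. l i *\<^sub>R a ! i)}" "q \<in> {p. \<exists>l. p = (\<Sum>i<length a. l i *\<^sub>R a ! i)}"
      then obtain l m where "p = (\<Sum>i<length a. l i *\<^sub>R a ! i)" "q = (\<Sum>i<length a. m i *\<^sub>R a ! i)" by blast
      then show "\<exists>l. p + q = (\<Sum>i<length a. l i *\<^sub>R a ! i)"
        by (intro exI[of _ "\<lambda>i. l i + m i"]) (simp add: scaleR_add_left sum.distrib)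
    next
      fix c p assume "p \<in> {p. \<exists>l. p = (\<Sum>i<length a. l i *\<^sub>R a ! i)}"
      then obtain l where "p = (\<Sum>i<length a. l i *\<^sub>R a ! i)" by blast
      then show "\<exists>l. c *\<^sub>R p = (\<Sum>i<length a. l i *\<^sub>R a ! i)"
        by (intro exI[of _ "\<lambda>i. c * l i"]) (simp add: scaleR_sum_right)
    qed
  next
    case (step p)
    then obtain j where j: "j < length a" "p = a ! j" by (auto simp: in_set_conv_nth)
    have "(\<Sum>i<length a. (if i = j then 1 else 0) *\<^sub>R a ! i) = (\<Sum>i<length a. if i = j then a ! i else 0)"
      by (intro sum.cong) auto
    with j show ?case by (intro exI[of _ "\<lambda>i. if i = j then 1 else 0"]) simp
  qed
  then show thesis using that by blast
qed

lemma infeasible_certificate: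
  fixes h g a :: "('n::finite rpoly) list"
  assumes a: "set a \<subseteq> polys_in A" and arch: "archimedean h g"
    and p: "p \<in> span (set a)" "\<And>x. x \<in> semialg h g \<Longrightarrow> 0 < peval p x"
    and inf: "\<not> feasible a b A (semialg h g)"
  shows "\<exists>lam k. certificate k lam a b h g"
proof -
  obtain l0 where l0: "p = (\<Sum>i<length a. l0 i *\<^sub>R (a ! i))" using span_list[OF p(1)] by blast
  obtain l where l: "\<forall>x\<in>semialg h g. 0 < (\<Sum>i<length a. l i * peval (a ! i) x)"
    "(\<Sum>i<length a. l i * b ! i) < 0"
  proof -
    have "\<exists>l. (\<forall>x\<in>semialg h g. 0 < (\<Sum>i<length a. l i * peval (a ! i) x)) \<and> (\<Sum>i<length a. l i * b ! i) < 0"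
    proof (rule strict_separation_compact)
      show "\<not> conic_combination {..<length a} (\<lambda>x i. peval (a ! i) x) (semialg h g) (\<lambda>i. b ! i)"
        using conic_combination_feasible[OF a] inf by blast
      show "0 < (\<Sum>i<length a. l0 i * peval (a ! i) x)" if "x \<in> semialg h g" for x
        using p(2)[OF that] by (simp add: l0 peval_sum peval_scaleR)
    qed (auto intro: compact_semialg[OF arch] continuous_on_peval)
    then show thesis using that by blast
  qed
  let ?f = "\<Sum>i<length a. l i *\<^sub>R (a ! i)"
  have "?f \<in> ideal_of h + qmodule g"
    using l(1) by (intro putinar[OF arch]) (simp add: peval_sum peval_scaleR)
  then obtain k where k: "?f \<in> qmodule_trunc k g + ideal_trunc (2 * k) h" by (rule ideal_plus_qmodule_trunc)
  have "certificate k (map l [0..<length a]) a b h g"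
    using k l(2) by (simp add: certificate_def mult.commute)
  then show ?thesis by blast
qed

theorem lemma5p3:
  fixes h g a :: "('n::finite rpoly) list"
    and b :: "real list"
    and A :: "('n expo) set"
  assumes "finite A"
    and "set a \<subseteq> polys_in A"
    and "length b = length a"
  shows
    "((\<exists>k. is_order A k \<and> \<not> feasible_rel k a b A h g) \<longrightarrow> \<not> feasible a b A (semialg h g)) \<and>
     ((\<exists>lam k. certificate k lam a b h g) \<longrightarrow> (\<exists>k. is_order A k \<and> \<not> feasible_rel k a b A h g)) \<and>
     (archimedean h g \<and>
      (\<exists>p \<in> span (set a). \<forall>x \<in> semialg h g. peval p x > 0) \<and>
      \<not> feasible a b A (semialg h g) \<longrightarrow>
      (\<exists>lam k. certificate k lam a b h g) \<and>
      (\<exists>k. is_order A k \<and> \<not> feasible_rel k a b A h g))"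
proof -
  have sound: "\<exists>k. is_order A k \<and> \<not> feasible_rel k a b A h g" if "certificate k lam a b h g" for k lam
  proof (intro exI conjI)
    \<comment> \<open>The summand \<open>2 * k\<close> serves the certificate, the summand
      \<open>deg_set A\<close> makes the order admissible.\<close>
    show "is_order A (2 * k + deg_set A)" by (simp add: is_order_def)
    show "\<not> feasible_rel (2 * k + deg_set A) a b A h g"
      by (rule certificate_infeasible[OF assms(1,2) that]) simp
  qed
  moreover have "\<exists>lam k. certificate k lam a b h g"
    if "archimedean h g" "\<exists>p \<in> span (set a). \<forall>x \<in> semialg h g. peval p x > 0"
      "\<not> feasible a b A (semialg h g)"
    using that infeasible_certificate[OF assms(2)] by blast
  moreover have "\<not> feasible a b A (semialg h g)" if "is_order A k" "\<not> feasible_rel k a b A h g" for k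
    using feasible_imp_feasible_rel[OF assms(1)] that by blast
  ultimately show ?thesis by meson
qed

end
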